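(* Let $d\geqslant 1$ and let $\mathcal{S}=(A_n)_{n\in\mathbb{N}}$ be a sequence of $d\times d$ integer matrices such that for some real $\tau\geqslant 1/d$ and all $N\in\mathbb{N}$, $$\frac1N\sum_{n=1}^N\|A_n\|\ll N^\tau,$$ and such that $A_n-A_m$ is invertible for all $n\neq m$. Let $\mathcal{E}_{\mathcal{S}}$ be the set of points $\mathbf{x}\in[0,1]^d$ (viewed as row vectors) such that the sequence $\mathbf{x}A_n$, $n=1,2,\ldots$, is not uniformly distributed modulo $1$ in $[0,1)^d$. Then $$\dim\mathcal{E}_{\mathcal{S}}\leqslant d-1/\tau,$$ where $\dim$ denotes Hausdorff dimension.
   Context: For a $d\times d$ matrix $A$, $\|A\|=\sup\{\|\mathbf{x}A\|:\ \mathbf{x}\in\mathbb{R}^d,\ \|\mathbf{x}\|=1\}$ is the operator norm, with $\|\cdot\|$ the Euclidean norm. The notation $U\ll V$ means $|U|\leqslant cV$ for some constant $c>0$ independent of $N$. *)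

theory Defs
  imports "HOL-Analysis.Analysis"
begin

definition row_opnorm :: "real ^ 'n ^ 'm \<Rightarrow> real" where
  "row_opnorm A = (SUP x\<in>{x :: real ^ 'm. norm x = 1}. norm (x v* A))"

text \<open>
  Sequences are indexed from 1; the value of \<open>u\<close> at 0 plays no role.
\<close>

definition uniformly_distributed_mod1 :: "(nat \<Rightarrow> real ^ 'n) \<Rightarrow> bool" where
  "uniformly_distributed_mod1 u \<longleftrightarrow>
     (\<forall>a b :: real ^ 'n. (\<forall>i. 0 \<le> a $ i \<and> a $ i < b $ i \<and> b $ i \<le> 1) \<longrightarrow>
        (\<lambda>N. real (card {n \<in> {1..N}. \<forall>i. frac (u n $ i) \<in> {a $ i..<b $ i}}) / real N)
          \<longlonglongrightarrow> (\<Prod>i\<in>UNIV. b $ i - a $ i))"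

text \<open>
  The \<open>s\<close>-th power of the diameter with the conventions of Hausdorff measure: the empty set
  contributes 0, and for \<open>s = 0\<close> every nonempty set contributes 1 (whereas \<open>0 powr 0 = 0\<close>).
\<close>

definition diam_power :: "real \<Rightarrow> 'a::metric_space set \<Rightarrow> ennreal" where
  "diam_power s U =
     (if U = {} then 0 else if s = 0 then 1 else ennreal (diameter U powr s))"

text \<open>
  Boundedness of the covering sets is required explicitly because \<^const>\<open>diameter\<close> is
  real-valued and carries no information on unbounded sets.
\<close>

definition hausdorff_premeasure :: "real \<Rightarrow> real \<Rightarrow> 'a::metric_space set \<Rightarrow> ennreal" where
  "hausdorff_premeasure s \<delta> E =
     (INF U\<in>{U :: nat \<Rightarrow> 'a set. E \<subseteq> (\<Union>i. U i) \<and> (\<forall>i. bounded (U i) \<and> diameter (U i) \<le> \<delta>)}.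
        \<Sum>i. diam_power s (U i))"

definition hausdorff_measure :: "real \<Rightarrow> 'a::metric_space set \<Rightarrow> ennreal" where
  "hausdorff_measure s E = (SUP \<delta>\<in>{0<..}. hausdorff_premeasure s \<delta> E)"

definition hausdorff_dim :: "'a::metric_space set \<Rightarrow> ereal" where
  "hausdorff_dim E = (INF s\<in>{s. 0 \<le> s \<and> hausdorff_measure s E = 0}. ereal s)"

definition exceptional_set :: "(nat \<Rightarrow> real ^ 'n ^ 'n) \<Rightarrow> (real ^ 'n) set" where
  "exceptional_set A =
     {x. (\<forall>i. 0 \<le> x $ i \<and> x $ i \<le> 1) \<and> \<not> uniformly_distributed_mod1 (\<lambda>n. x v* A n)}"

end

theory Submission
  imports Defs
begin

text \<open>
  By Weyl's criterion an exceptional point \<open>x\<close> has, for some nonzero integer vector \<open>h\<close>, Weyl sums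
  \<open>S\<^sub>N(x) = \<Sum>n\<le>N. e(x \<bullet> v\<^sub>n)\<close>, \<open>v\<^sub>n = A\<^sub>n h\<close>, that are not \<open>o(N)\<close>. The \<open>v\<^sub>n\<close> are distinct integer
  vectors, so \<open>S\<^sub>N\<close> has mean square \<open>N\<close> over the unit cube, and \<open>S\<^sub>N\<close> is Lipschitz with constant
  \<open>O(N\<^bsup>1 + \<tau>\<^esup>)\<close>. Hence if \<open>|S\<^sub>N| \<ge> \<epsilon>N\<close> somewhere on a cell of side \<open>\<asymp> N\<^bsup>-\<tau>\<^esup>\<close>, then \<open>|S\<^sub>N| \<ge> \<epsilon>N/2\<close> on
  the whole cell, and there are only \<open>O(N\<^bsup>\<tau>d - 1\<^esup>)\<close> such cells. The sums of the \<open>s\<close>-th powers of their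
  diameters are \<open>O(N\<^bsup>\<tau>(d - s) - 1\<^esup>)\<close>, with a negative exponent when \<open>s > d - 1/\<tau>\<close>; along \<open>N = k^M\<close> with
  \<open>M\<close> large they are summable in \<open>k\<close>. This sparse sequence suffices because consecutive terms have
  ratio tending to 1.
\<close>

subsection \<open>Characters on cubes\<close>

text \<open>The side is a parameter because two cubes occur: side 1 in Weyl's criterion and side 2
  in the mean square of \<open>superlevel_cover\<close>. For every natural \<open>L\<close> the cube
  consists of whole periods of the integer characters.\<close>

definition cube_measure :: "nat \<Rightarrow> 'a::euclidean_space measure" where
  "cube_measure L = restrict_space lborel (cbox 0 (real L *\<^sub>R One))"

definition character :: "'a::real_inner \<Rightarrow> 'a \<Rightarrow> complex" where
  "character h x = cis (2 * pi * (h \<bullet> x))"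

definition integer_vec :: "'a::euclidean_space \<Rightarrow> bool" where
  "integer_vec h \<longleftrightarrow> (\<forall>b\<in>Basis. h \<bullet> b \<in> \<int>)"

lemma norm_character [simp]: "norm (character h x) = 1"
  by (simp add: character_def)

lemma continuous_on_character [continuous_intros]: "continuous_on S (character h)"
  unfolding character_def by (intro continuous_intros)

lemma character_mult: "character g x * character h x = character (g + h) x"
  by (simp add: character_def cis_mult inner_add_left algebra_simps)

lemma cnj_character: "cnj (character h x) = character (- h) x"
  by (simp add: character_def cis_cnj)

lemma space_cube_measure: "space (cube_measure L) = cbox 0 (real L *\<^sub>R One)"
  by (simp add: cube_measure_def space_restrict_space)

lemma measure_cube_measure:
  "measure (cube_measure L) (cbox 0 (real L *\<^sub>R One :: 'a)) = real L ^ DIM('a::euclidean_space)"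
  unfolding cube_measure_def
  by (subst measure_restrict_space) auto

lemma finite_measure_cube: "finite_measure (cube_measure L :: 'a::euclidean_space measure)"
proof
  show "emeasure (cube_measure L :: 'a measure) (space (cube_measure L)) \<noteq> \<infinity>"
    unfolding space_cube_measure unfolding cube_measure_def
    by (subst emeasure_restrict_space) auto
qed

lemma borel_measurable_cube_continuous:
  fixes f :: "'a::euclidean_space \<Rightarrow> 'b::topological_space"
  assumes "continuous_on UNIV f"
  shows "f \<in> borel_measurable (cube_measure L)"
  unfolding cube_measure_def using borel_measurable_continuous_onI[OF assms]
  by (simp add: measurable_restrict_space1)

lemma integrable_cube_continuous:
  fixes f :: "'a::euclidean_space \<Rightarrow> 'b::{banach,second_countable_topology}"
  assumes "continuous_on UNIV f"
  shows "integrable (cube_measure L) f"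
proof -
  have "compact (f ` cbox 0 (real L *\<^sub>R One))"
    using assms by (intro compact_continuous_image) (auto intro: continuous_on_subset)
  then obtain B where "\<And>x. x \<in> cbox 0 (real L *\<^sub>R One) \<Longrightarrow> norm (f x) \<le> B"
    using compact_imp_bounded bounded_iff by (metis (no_types, lifting) imageI)
  then have "AE x in cube_measure L. norm (f x) \<le> B"
    by (intro AE_I2) (auto simp: space_cube_measure)
  then show ?thesis
    using borel_measurable_cube_continuous[OF assms]
    by (rule finite_measure.integrable_const_bound[OF finite_measure_cube])
qed

text \<open>By \<open>lborel_eq\<close>, Lebesgue measure is the image of the product measure over
  \<open>Basis\<close>, so Fubini factors the integral.\<close>

lemma lborel_integral_prod_Basis:
  fixes f :: "'a::euclidean_space \<Rightarrow> real \<Rightarrow> complex"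
  assumes int: "\<And>b. b \<in> Basis \<Longrightarrow> integrable lborel (f b)"
  shows "(\<integral>x. (\<Prod>b\<in>Basis. f b (x \<bullet> b)) \<partial>lborel) = (\<Prod>b\<in>Basis. \<integral>t. f b t \<partial>lborel)"
proof -
  interpret product_sigma_finite "\<lambda>_::'a. lborel :: real measure"
    by (simp add: product_sigma_finite_def sigma_finite_lborel)
  have [measurable]: "f b \<in> borel_measurable borel" if "b \<in> Basis" for b
    using int[OF that] by (auto dest: borel_measurable_integrable)
  have "(\<integral>x. (\<Prod>b\<in>Basis. f b (x \<bullet> b)) \<partial>lborel)
      = (\<integral>g. (\<Prod>b\<in>Basis. f b ((\<Sum>c\<in>Basis. g c *\<^sub>R c) \<bullet> b)) \<partial>(\<Pi>\<^sub>M b\<in>Basis. lborel))"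
    by (subst lborel_eq, subst integral_distr) auto
  also have "\<dots> = (\<integral>g. (\<Prod>b\<in>Basis. f b (g b)) \<partial>(\<Pi>\<^sub>M b\<in>Basis. lborel))"
    by (intro Bochner_Integration.integral_cong prod.cong) auto
  also have "\<dots> = (\<Prod>b\<in>Basis. \<integral>t. f b t \<partial>lborel)"
    by (rule product_integral_prod) (auto intro: int)
  finally show ?thesis .
qed

text \<open>The antiderivative \<open>?F\<close> agrees at 0 and \<open>L\<close> because
  \<open>m * L\<close> is an integer, so the fundamental theorem of calculus gives 0.\<close>

lemma has_integral_cis_period:
  fixes m :: real
  assumes "m \<in> \<int>" "m \<noteq> 0"
  shows "has_bochner_integral lborel (\<lambda>t. indicator {0..real L} t *\<^sub>R cis (2 * pi * (m * t))) 0"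
proof -
  let ?F = "\<lambda>t. cis (2 * pi * (m * t)) / (2 * pi * m * \<i>)"
  have "has_bochner_integral lborel (\<lambda>t. indicator {0..real L} t *\<^sub>R cis (2 * pi * (m * t)))
      (?F (real L) - ?F 0)"
  proof (rule has_bochner_integral_FTC_Icc)
    fix t
    show "(?F has_vector_derivative cis (2 * pi * (m * t))) (at t within {0..real L})"
      unfolding has_vector_derivative_def
      by (rule derivative_eq_intros refl | simp)+ (use assms in \<open>auto simp: field_simps scaleR_conv_of_real\<close>)
  qed (auto intro!: continuous_intros)
  moreover have "cis (2 * pi * (m * real L)) = 1"
    using assms by (intro cis_multiple_2pi) auto
  ultimately show ?thesis by simp
qed

lemma character_eq_prod: "character h x = (\<Prod>b\<in>Basis. cis (2 * pi * ((h \<bullet> b) * (x \<bullet> b))))"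
  unfolding character_def by (subst euclidean_inner)
    (simp add: cis_conv_exp sum_distrib_left flip: exp_sum)

text \<open>The character factors over the coordinates, and a direction \<open>b\<close> with
  \<open>h \<bullet> b \<noteq> 0\<close> contributes a factor that integrates to 0 over whole
  periods.\<close>

lemma integral_cube_character:
  fixes h :: "'a::euclidean_space"
  assumes "integer_vec h" "h \<noteq> 0"
  shows "(\<integral>x. character h x \<partial>cube_measure L) = 0"
proof -
  let ?f = "\<lambda>b t. indicator {0..real L} t *\<^sub>R cis (2 * pi * ((h \<bullet> b) * t))"
  have ind: "indicator (cbox 0 (real L *\<^sub>R One)) x = (\<Prod>b\<in>Basis. indicator {0..real L} (x \<bullet> b) :: real)"
    for x :: 'a by (auto simp: mem_box split: split_indicator)
  have "(\<integral>x. character h x \<partial>cube_measure L) = (\<integral>x. (\<Prod>b\<in>Basis. ?f b (x \<bullet> b)) \<partial>lborel)"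
    unfolding cube_measure_def
    by (subst integral_restrict_space)
      (auto simp: ind character_eq_prod prod.distrib scaleR_conv_of_real intro!: Bochner_Integration.integral_cong)
  also have "\<dots> = (\<Prod>b\<in>Basis. \<integral>t. ?f b t \<partial>lborel)"
    by (intro lborel_integral_prod_Basis borel_integrable_compact) (auto intro!: continuous_intros)
  also obtain b where "b \<in> Basis" "h \<bullet> b \<noteq> 0"
    using assms(2) by (metis euclidean_all_zero_iff)
  then have "(\<integral>t. ?f b t \<partial>lborel) = 0"
    using assms by (intro has_bochner_integral_integral_eq has_integral_cis_period) (auto simp: integer_vec_def)
  with \<open>b \<in> Basis\<close> have "(\<Prod>b\<in>Basis. \<integral>t. ?f b t \<partial>lborel) = 0"
    by (meson finite_Basis prod_zero)
  finally show ?thesis .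
qed

lemma integer_vec_diff: "integer_vec g \<Longrightarrow> integer_vec h \<Longrightarrow> integer_vec (g - h)"
  by (auto simp: integer_vec_def inner_diff_left)

lemma integer_vec_add: "integer_vec g \<Longrightarrow> integer_vec h \<Longrightarrow> integer_vec (g + h)"
  by (auto simp: integer_vec_def inner_add_left)

text \<open>Orthogonality of characters: the square expands into characters of the differences
  \<open>v i - v j\<close>. These are nonzero integer vectors off the diagonal by injectivity, so
  only the diagonal survives, each term giving the volume of the cube.\<close>

lemma integral_cube_norm_character_sum_sq:
  fixes v :: "'i \<Rightarrow> 'a::euclidean_space"
  assumes "finite I" "inj_on v I" "\<And>i. i \<in> I \<Longrightarrow> integer_vec (v i)"
  shows "(\<integral>x. (norm (\<Sum>i\<in>I. character (v i) x))\<^sup>2 \<partial>cube_measure L) = real L ^ DIM('a) * real (card I)"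
proof -
  have eq: "complex_of_real ((norm (\<Sum>i\<in>I. character (v i) x))\<^sup>2) = (\<Sum>i\<in>I. \<Sum>j\<in>I. character (v i - v j) x)" for x
    by (simp only: complex_norm_square cnj_sum sum_product cnj_character character_mult) simp
  have "complex_of_real (\<integral>x. (norm (\<Sum>i\<in>I. character (v i) x))\<^sup>2 \<partial>cube_measure L)
      = (\<integral>x. (\<Sum>i\<in>I. \<Sum>j\<in>I. character (v i - v j) x) \<partial>cube_measure L)"
    by (simp only: flip: eq integral_complex_of_real)
  also have "\<dots> = (\<Sum>i\<in>I. \<Sum>j\<in>I. \<integral>x. character (v i - v j) x \<partial>cube_measure L)"
    by (subst Bochner_Integration.integral_sum,
        force intro!: Bochner_Integration.integrable_sum integrable_cube_continuous continuous_intros)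
       (intro sum.cong refl Bochner_Integration.integral_sum integrable_cube_continuous continuous_intros)
  also have "\<dots> = (\<Sum>i\<in>I. \<Sum>j\<in>I. if i = j then of_real (real L ^ DIM('a)) else 0)"
  proof (intro sum.cong refl)
    fix i j assume ij: "i \<in> I" "j \<in> I"
    show "(\<integral>x. character (v i - v j) x \<partial>cube_measure L) = (if i = j then of_real (real L ^ DIM('a)) else 0)"
    proof (cases "i = j")
      case True
      then have "character (v i - v j) = (\<lambda>_. 1)" by (simp add: character_def fun_eq_iff)
      then show ?thesis using True
        by (simp add: measure_cube_measure space_cube_measure scaleR_conv_of_real)
    next
      case False
      with assms ij have "v i - v j \<noteq> 0" by (auto simp: inj_on_def)
      with False show ?thesis using assms(3) ij by (simp add: integral_cube_character integer_vec_diff)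
    qed
  qed
  also have "\<dots> = complex_of_real (real L ^ DIM('a) * real (card I))"
    using assms(1) by simp
  finally show ?thesis using of_real_eq_iff by blast
qed

section \<open>Lipschitz bounds for characters\<close>

lemma norm_cis_diff_le: "norm (cis a - cis b) \<le> \<bar>a - b\<bar>"
proof -
  have "norm (cis a - cis b) \<le> 1 * norm (a - b)"
  proof (rule differentiable_bound[of UNIV])
    show "(cis has_derivative (\<lambda>h. h *\<^sub>R (\<i> * cis x))) (at x within UNIV)" for x
      by (rule derivative_eq_intros refl | simp)+
    show "onorm (\<lambda>h. h *\<^sub>R (\<i> * cis x)) \<le> 1" for x
      by (rule onorm_le) (simp add: norm_mult)
  qed auto
  then show ?thesis by simp
qed

lemma norm_character_diff_le: "norm (character h x - character h y) \<le> 2 * pi * norm h * dist x y"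
proof -
  have "norm (character h x - character h y) \<le> 2 * pi * \<bar>h \<bullet> (x - y)\<bar>"
    unfolding character_def using norm_cis_diff_le[of "2 * pi * (h \<bullet> x)" "2 * pi * (h \<bullet> y)"]
    by (simp add: inner_diff_right abs_mult flip: right_diff_distrib)
  also have "\<dots> \<le> 2 * pi * (norm h * norm (x - y))"
    by (intro mult_left_mono Cauchy_Schwarz_ineq2) auto
  finally show ?thesis by (simp add: dist_norm)
qed

subsection \<open>Weyl's criterion\<close>

text \<open>The torus is realised as a product of unit circles. A function of
  \<open>torus_map x\<close> is automatically periodic, and Stone-Weierstrass for ordinary real
  polynomials on a ball then yields trigonometric polynomials in \<open>x\<close>.\<close>

definition torus_map :: "real ^ 'n \<Rightarrow> complex ^ 'n" where
  "torus_map x = (\<chi> i. cis (2 * pi * x $ i))"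

definition frac_vec :: "real ^ 'n \<Rightarrow> real ^ 'n" where
  "frac_vec x = (\<chi> i. frac (x $ i))"

lemma continuous_on_torus_map [continuous_intros]: "continuous_on S torus_map"
  unfolding torus_map_def by (intro continuous_intros)

lemma norm_torus_map_le: "norm (torus_map x :: complex ^ 'n) \<le> real CARD('n)"
proof -
  have "norm (torus_map x) \<le> (\<Sum>i\<in>UNIV. norm (torus_map x $ i))"
    unfolding norm_vec_def by (rule L2_set_le_sum) auto
  then show ?thesis by (simp add: torus_map_def)
qed

lemma torus_map_frac_vec: "torus_map (frac_vec x) = torus_map x"
proof -
  have "cis (2 * pi * frac t) = cis (2 * pi * t)" for t :: real
  proof -
    have "cis (2 * pi * frac t) = cis (2 * pi * t) / cis (2 * pi * of_int \<lfloor>t\<rfloor>)"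
      by (simp add: frac_def cis_divide right_diff_distrib del: cis_multiple_2pi)
    then show ?thesis by simp
  qed
  then show ?thesis by (simp add: torus_map_def frac_vec_def)
qed

lemma Ball_Basis_vec_iff: "(\<forall>b\<in>Basis. P (x \<bullet> b)) \<longleftrightarrow> (\<forall>i. P (x $ i))" for x :: "real ^ 'n"
  by (auto simp: Basis_vec_def inner_axis)

lemma mem_cbox_One_iff: "x \<in> cbox 0 (One :: real ^ 'n) \<longleftrightarrow> (\<forall>i. 0 \<le> x $ i \<and> x $ i \<le> 1)"
  using Ball_Basis_vec_iff[of "\<lambda>t. 0 \<le> t \<and> t \<le> 1" x] by (simp add: mem_box)

lemma mem_box_One_iff: "x \<in> box 0 (One :: real ^ 'n) \<longleftrightarrow> (\<forall>i. 0 < x $ i \<and> x $ i < 1)"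
  using Ball_Basis_vec_iff[of "\<lambda>t. 0 < t \<and> t < 1" x] by (simp add: mem_box)

lemma cis_2pi_eq_imp_eq:
  fixes s t :: real
  assumes "cis (2 * pi * s) = cis (2 * pi * t)" "\<bar>s - t\<bar> < 1"
  shows "s = t"
proof -
  have "cis (2 * pi * s - 2 * pi * t) = 1"
    using assms(1) by (simp flip: cis_divide)
  then have "cos (2 * pi * s - 2 * pi * t) = 1"
    by (metis cis.sel(1) one_complex.sel(1))
  then obtain m :: int where "2 * pi * s - 2 * pi * t = of_int m * 2 * pi"
    by (auto simp: cos_one_2pi_int)
  then have "2 * pi * (s - t) = 2 * pi * of_int m" by (simp add: algebra_simps)
  then have "s - t = of_int m" by simp
  with assms(2) show ?thesis by (simp add: flip: of_int_abs)
qed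

text \<open>\<open>torus_map\<close> glues only boundary points of the cube. A coordinate of an
  interior point and one of a point of the closed cube differ by less than 1, so congruence modulo 1
  forces equality.\<close>

lemma torus_map_mem_image_iff:
  assumes "x \<in> box 0 One" "B \<subseteq> cbox 0 One"
  shows "torus_map x \<in> torus_map ` B \<longleftrightarrow> x \<in> B"
proof
  assume "torus_map x \<in> torus_map ` B"
  then obtain y where y: "y \<in> B" "torus_map x = torus_map y" by auto
  have "x $ i = y $ i" for i
  proof (rule cis_2pi_eq_imp_eq)
    show "cis (2 * pi * x $ i) = cis (2 * pi * y $ i)"
      using y(2) by (simp add: torus_map_def vec_eq_iff)
    have "0 < x $ i" "x $ i < 1" "0 \<le> y $ i" "y $ i \<le> 1"
      using assms y(1) mem_cbox_One_iff[of y] mem_box_One_iff[of x] by auto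
    then show "\<bar>x $ i - y $ i\<bar> < 1" by linarith
  qed
  with y(1) show "x \<in> B" by (metis vec_eq_iff)
qed auto

section \<open>Trigonometric polynomials from polynomials on the torus\<close>

inductive trig_poly :: "('a::euclidean_space \<Rightarrow> complex) \<Rightarrow> bool" where
  monomial: "integer_vec h \<Longrightarrow> trig_poly (\<lambda>x. c * character h x)"
| add: "trig_poly f \<Longrightarrow> trig_poly g \<Longrightarrow> trig_poly (\<lambda>x. f x + g x)"

lemma trig_poly_const: "trig_poly (\<lambda>x. c)"
  using trig_poly.monomial[of 0 c] by (simp add: character_def integer_vec_def)

lemma trig_poly_mult:
  assumes "trig_poly f" "trig_poly g"
  shows "trig_poly (\<lambda>x. f x * g x)"
  using assms(1)
proof induction
  case (monomial h c)
  from assms(2) show ?case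
  proof induction
    case (monomial h' c')
    have "(\<lambda>x. c * character h x * (c' * character h' x)) = (\<lambda>x. (c * c') * character (h + h') x)"
      by (simp add: fun_eq_iff mult_ac flip: character_mult)
    then show ?case using monomial \<open>integer_vec h\<close>
      by (metis integer_vec_add trig_poly.monomial)
  next
    case (add f g)
    then show ?case using trig_poly.add[OF add.IH] by (simp add: distrib_left)
  qed
next
  case (add f f')
  then show ?case using trig_poly.add[OF add.IH] by (simp add: distrib_right)
qed

lemma trig_poly_sum:
  "finite I \<Longrightarrow> (\<And>i. i \<in> I \<Longrightarrow> trig_poly (f i)) \<Longrightarrow> trig_poly (\<lambda>x. \<Sum>i\<in>I. f i x)"
  by (induction I rule: finite_induct) (auto intro: trig_poly_const trig_poly.add)

text \<open>Real coordinates of \<open>torus_map x\<close> are cosines and sines of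
  \<open>2 * pi * x $ i\<close>; Euler's formulas write them with the two characters of frequency
  plus and minus \<open>axis i 1\<close>.\<close>

lemma trig_poly_torus_map_component:
  fixes b :: "complex ^ 'n"
  assumes "b \<in> Basis"
  shows "trig_poly (\<lambda>x. complex_of_real (torus_map x \<bullet> b))"
proof -
  obtain i u where u: "u \<in> Basis" and b: "b = axis i u"
    using assms by (auto simp: Basis_vec_def)
  have int: "integer_vec (axis i 1 :: real ^ 'n)" "integer_vec (- axis i 1 :: real ^ 'n)"
    by (auto simp: integer_vec_def Basis_vec_def inner_axis_axis)
  have p: "character (axis i 1) x = cis (2 * pi * x $ i)" "character (- axis i 1) x = cis (- (2 * pi * x $ i))"
    for x :: "real ^ 'n"
    by (simp_all add: character_def inner_axis')
  from u consider "u = 1" | "u = \<i>" by (auto simp: Basis_complex_def)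
  then show ?thesis
  proof cases
    case 1
    have "(\<lambda>x. complex_of_real (torus_map x \<bullet> b)) = (\<lambda>x. 1 / 2 * character (axis i 1) x + 1 / 2 * character (- axis i 1) x)"
      by (auto simp: fun_eq_iff p b 1 inner_axis torus_map_def complex_eq_iff)
    then show ?thesis by (simp only:) (intro trig_poly.intros int)
  next
    case 2
    have "(\<lambda>x. complex_of_real (torus_map x \<bullet> b)) = (\<lambda>x. - \<i> / 2 * character (axis i 1) x + \<i> / 2 * character (- axis i 1) x)"
      by (auto simp: fun_eq_iff p b 2 inner_axis torus_map_def complex_eq_iff)
    then show ?thesis by (simp only:) (intro trig_poly.intros int)
  qed
qed

text \<open>A linear form is a combination of coordinates, which are trigonometric polynomials, and
  these are closed under sums and products.\<close>

lemma trig_poly_of_real_polynomial: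
  assumes "real_polynomial_function (g :: complex ^ 'n \<Rightarrow> real)"
  shows "trig_poly (\<lambda>x. complex_of_real (g (torus_map x)))"
  using assms
proof induction
  case (linear f)
  have rep: "f z = (\<Sum>b\<in>Basis. (z \<bullet> b) * f b)" for z
  proof -
    have "f z = f (\<Sum>b\<in>Basis. (z \<bullet> b) *\<^sub>R b)" by (simp add: euclidean_representation)
    then show ?thesis using bounded_linear.linear[OF linear] by (simp add: linear_sum linear_scale)
  qed
  have "(\<lambda>x. complex_of_real (f (torus_map x)))
      = (\<lambda>x. \<Sum>b\<in>Basis. complex_of_real (torus_map x \<bullet> b) * complex_of_real (f b))"
    by (rule ext, subst rep) simp
  then show ?case
    by (simp only:) (intro trig_poly_sum trig_poly_mult trig_poly_const trig_poly_torus_map_component finite_Basis)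
next
  case (const c)
  then show ?case by (rule trig_poly_const)
next
  case (add f g)
  then show ?case using trig_poly.add[OF add.IH] by simp
next
  case (mult f g)
  then show ?case using trig_poly_mult[OF mult.IH] by simp
qed

lemma continuous_on_trig_poly: "trig_poly f \<Longrightarrow> continuous_on UNIV f"
  by (induction rule: trig_poly.induct) (auto intro!: continuous_intros)

section \<open>Averages of continuous functions along the sequence\<close>

context
  fixes u :: "nat \<Rightarrow> real ^ 'n"
  assumes weyl_sums: "\<And>h. integer_vec h \<Longrightarrow> h \<noteq> 0 \<Longrightarrow> (\<lambda>N. (\<Sum>n=1..N. character h (u n)) / of_nat N) \<longlonglongrightarrow> 0"
begin

text \<open>For a monomial of nonzero frequency both sides are 0, by the hypothesis on Weyl sums and
  by \<open>integral_cube_character\<close>; frequency 0 gives the constant \<open>c\<close>. Sums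
  follow by linearity.\<close>

lemma trig_poly_average_tendsto:
  assumes "trig_poly f"
  shows "(\<lambda>N. (\<Sum>n=1..N. f (u n)) / of_nat N) \<longlonglongrightarrow> (\<integral>x. f x \<partial>cube_measure 1)"
  using assms
proof induction
  case (monomial h c)
  show ?case
  proof (cases "h = 0")
    case True
    \<comment> \<open>Only eventually, since at \<open>N = 0\<close> the quotient is 0 by the
      convention for division by zero.\<close>
    have "\<forall>\<^sub>F N in sequentially. (\<Sum>n=1..N. c * character h (u n)) / of_nat N = c"
      using eventually_gt_at_top[of 0] by eventually_elim (simp add: True character_def)
    moreover have "(\<integral>x. c * character h x \<partial>cube_measure 1) = c"
      using measure_cube_measure[of 1, where 'a = "real ^ 'n"] space_cube_measure[of 1, where 'a = "real ^ 'n"]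
      by (simp add: True character_def)
    ultimately show ?thesis by (simp only: tendsto_eventually)
  next
    case False
    have "(\<integral>x. c * character h x \<partial>cube_measure 1) = 0"
      using integral_cube_character[OF monomial False] by simp
    moreover have "(\<lambda>N. (\<Sum>n=1..N. c * character h (u n)) / of_nat N) \<longlonglongrightarrow> 0"
      using tendsto_mult_left[OF weyl_sums[OF monomial False], of c]
      by (simp add: sum_distrib_left)
    ultimately show ?thesis by (simp only:)
  qed
next
  case (add f g)
  have "(\<integral>x. f x + g x \<partial>cube_measure 1) = (\<integral>x. f x \<partial>cube_measure 1) + (\<integral>x. g x \<partial>cube_measure 1)"
    using add.hyps by (intro Bochner_Integration.integral_add integrable_cube_continuous continuous_on_trig_poly)
  then show ?case using tendsto_add[OF add.IH] by (simp add: sum.distrib add_divide_distrib)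
qed

text \<open>All values of \<open>torus_map\<close> lie in the ball of radius
  \<open>CARD('n)\<close>, where a polynomial \<open>g\<close> approximates \<open>F\<close> within
  \<open>e / 3\<close>. Replacing \<open>F\<close> by \<open>g\<close> costs at most
  \<open>e / 3\<close> in the average and in the integral, and the averages of \<open>g\<close>
  converge.\<close>

lemma continuous_average_tendsto:
  fixes F :: "complex ^ 'n \<Rightarrow> real"
  assumes F: "continuous_on UNIV F"
  shows "(\<lambda>N. (\<Sum>n=1..N. F (torus_map (u n))) / real N) \<longlonglongrightarrow> (\<integral>x. F (torus_map x) \<partial>cube_measure 1)"
proof (rule LIMSEQ_I)
  fix e :: real assume "0 < e"
  then have "e / 3 > 0" by simp
  have "continuous_on (cball 0 (real CARD('n))) F" using F by (rule continuous_on_subset) auto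
  then obtain g where g: "real_polynomial_function g"
    and gF: "\<And>z. z \<in> cball 0 (real CARD('n)) \<Longrightarrow> \<bar>F z - g z\<bar> < e / 3"
    using Stone_Weierstrass_real_polynomial_function[OF compact_cball _ \<open>e / 3 > 0\<close>] by metis
  have close: "\<bar>F (torus_map x) - g (torus_map x)\<bar> \<le> e / 3" for x
    using gF[of "torus_map x"] norm_torus_map_le[of x] by force
  have gc: "continuous_on UNIV g"
    using g by (simp add: continuous_on_polymonial_function real_polynomial_function_eq)
  have comp: "continuous_on UNIV (\<lambda>x. G (torus_map x))" if "continuous_on UNIV G" for G :: "complex ^ 'n \<Rightarrow> real"
    using that by (intro continuous_on_compose2[OF that] continuous_intros) auto
  have "(\<lambda>N. complex_of_real ((\<Sum>n=1..N. g (torus_map (u n))) / real N))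
      \<longlonglongrightarrow> complex_of_real (\<integral>x. g (torus_map x) \<partial>cube_measure 1)"
    using trig_poly_average_tendsto[OF trig_poly_of_real_polynomial[OF g]] by simp
  then have "(\<lambda>N. (\<Sum>n=1..N. g (torus_map (u n))) / real N) \<longlonglongrightarrow> (\<integral>x. g (torus_map x) \<partial>cube_measure 1)"
    unfolding tendsto_of_real_iff .
  then obtain N0 where N0: "\<And>N. N \<ge> N0 \<Longrightarrow>
      norm ((\<Sum>n=1..N. g (torus_map (u n))) / real N - (\<integral>x. g (torus_map x) \<partial>cube_measure 1)) < e / 3"
    using \<open>e / 3 > 0\<close> by (meson LIMSEQ_D)
  have "\<bar>(\<integral>x. F (torus_map x) \<partial>cube_measure 1) - (\<integral>x. g (torus_map x) \<partial>cube_measure 1)\<bar>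
      = \<bar>\<integral>x. F (torus_map x) - g (torus_map x) \<partial>cube_measure 1\<bar>"
    by (subst Bochner_Integration.integral_diff) (auto intro!: integrable_cube_continuous comp F gc)
  also have "\<dots> \<le> (\<integral>x. \<bar>F (torus_map x) - g (torus_map x)\<bar> \<partial>cube_measure 1)"
    by (rule integral_abs_bound)
  also have "\<dots> \<le> (\<integral>x. e / 3 \<partial>(cube_measure 1 :: (real ^ 'n) measure))"
    by (intro integral_mono integrable_cube_continuous continuous_intros comp F gc close)
  also have "\<dots> = e / 3"
    using measure_cube_measure[of 1, where 'a = "real ^ 'n"] space_cube_measure[of 1, where 'a = "real ^ 'n"]
    by simp
  finally have I: "\<bar>(\<integral>x. F (torus_map x) \<partial>cube_measure 1) - (\<integral>x. g (torus_map x) \<partial>cube_measure 1)\<bar> \<le> e / 3" .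
  have A: "\<bar>(\<Sum>n=1..N. F (torus_map (u n))) / real N - (\<Sum>n=1..N. g (torus_map (u n))) / real N\<bar> \<le> e / 3" for N
  proof (cases "N = 0")
    case False
    have "\<bar>(\<Sum>n=1..N. F (torus_map (u n))) - (\<Sum>n=1..N. g (torus_map (u n)))\<bar>
        \<le> (\<Sum>n=1..N. \<bar>F (torus_map (u n)) - g (torus_map (u n))\<bar>)"
      unfolding sum_subtractf[symmetric] by (rule sum_abs)
    also have "\<dots> \<le> (\<Sum>n=1..N. e / 3)" by (intro sum_mono close)
    finally show ?thesis using False by (simp add: field_simps flip: diff_divide_distrib)
  qed (use \<open>0 < e\<close> in simp)
  show "\<exists>N0. \<forall>N\<ge>N0. norm ((\<Sum>n=1..N. F (torus_map (u n))) / real N - (\<integral>x. F (torus_map x) \<partial>cube_measure 1)) < e"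
  proof (intro exI allI impI)
    fix N assume "N \<ge> N0"
    from N0[OF this] A[of N] I
    show "norm ((\<Sum>n=1..N. F (torus_map (u n))) / real N - (\<integral>x. F (torus_map x) \<partial>cube_measure 1)) < e"
      unfolding real_norm_def by linarith
  qed
qed

end

section \<open>Continuous approximations to indicators of closed sets\<close>

definition bump :: "'a::metric_space set \<Rightarrow> nat \<Rightarrow> 'a \<Rightarrow> real" where
  "bump K k z = max 0 (1 - real k * infdist z K)"

lemma continuous_on_bump: "continuous_on S (bump K k)"
  unfolding bump_def by (intro continuous_intros)

text \<open>Off a closed nonempty set \<open>infdist\<close> is positive, so the bump vanishes for
  large \<open>k\<close>. Nonemptiness matters: \<open>infdist\<close> to the empty set is 0 by
  convention, which would make the bump 1 everywhere.\<close>

lemma bump_tendsto_indicator: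
  assumes "closed K" "K \<noteq> {}"
  shows "(\<lambda>k. bump K k z) \<longlonglongrightarrow> indicator K z"
proof (cases "z \<in> K")
  case True
  then show ?thesis by (simp add: bump_def)
next
  case False
  with assms have "infdist z K > 0" by (simp add: infdist_pos_not_in_closed)
  then obtain k0 where "1 < real k0 * infdist z K" using reals_Archimedean3 by blast
  then have "bump K k z = 0" if "k \<ge> k0" for k
    using that \<open>infdist z K > 0\<close> mult_right_mono[of "real k0" "real k" "infdist z K"]
    unfolding bump_def by linarith
  then have "\<forall>\<^sub>F k in sequentially. bump K k z = 0"
    unfolding eventually_sequentially by blast
  with False show ?thesis by (simp add: tendsto_eventually)
qed

lemma AE_cube_measure_interior: "AE x in cube_measure 1. x \<in> box 0 (One :: 'a::euclidean_space)"
proof -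
  have "cbox 0 One - box 0 (One :: 'a) \<in> null_sets lborel"
    by (rule null_setsI) (simp_all add: emeasure_Diff emeasure_lborel_box_eq emeasure_lborel_cbox_eq subset_box)
  then have "AE x in lborel. x \<notin> cbox 0 One - box 0 (One :: 'a)"
    by (rule AE_not_in)
  then show ?thesis
    unfolding cube_measure_def by (subst AE_restrict_space_iff) auto
qed

text \<open>Dominated convergence with bound 1. Almost every point is interior to the cube, and
  there \<open>torus_map x\<close> lies in the image of \<open>B\<close> exactly when
  \<open>x\<close> lies in \<open>B\<close>.\<close>

lemma integral_bump_tendsto:
  fixes B :: "(real ^ 'n) set"
  assumes B: "compact B" "B \<subseteq> cbox 0 One" "B \<noteq> {}"
  shows "(\<lambda>k. \<integral>x. bump (torus_map ` B) k (torus_map x) \<partial>cube_measure 1) \<longlonglongrightarrow> measure lborel B"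
proof -
  have K: "closed (torus_map ` B)" "torus_map ` B \<noteq> {}"
    using B by (auto intro!: compact_imp_closed compact_continuous_image continuous_intros)
  have Bb [measurable]: "B \<in> sets borel" using B(1) by (simp add: borel_compact)
  have "(\<lambda>k. \<integral>x. bump (torus_map ` B) k (torus_map x) \<partial>cube_measure 1)
      \<longlonglongrightarrow> (\<integral>x. indicator B x \<partial>cube_measure 1)"
  proof (rule integral_dominated_convergence[where w = "\<lambda>_. 1"])
    show "indicator B \<in> borel_measurable (cube_measure 1)"
      unfolding cube_measure_def by (intro measurable_restrict_space1) simp
    show "(\<lambda>x. bump (torus_map ` B) k (torus_map x)) \<in> borel_measurable (cube_measure 1)" for k
      by (intro borel_measurable_cube_continuous continuous_on_compose2[OF continuous_on_bump, of UNIV]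
          continuous_intros) auto
    show "AE x in cube_measure 1. (\<lambda>k. bump (torus_map ` B) k (torus_map x)) \<longlonglongrightarrow> indicator B x"
      using AE_cube_measure_interior
    proof eventually_elim
      case (elim x)
      with B(2) have "indicator B x = (indicator (torus_map ` B) (torus_map x) :: real)"
        by (simp add: indicator_def torus_map_mem_image_iff)
      then show ?case using bump_tendsto_indicator[OF K] by simp
    qed
    show "AE x in cube_measure 1. norm (bump (torus_map ` B) k (torus_map x)) \<le> 1" for k
      by (intro AE_I2) (simp add: bump_def infdist_nonneg)
  qed (simp add: integrable_cube_continuous)
  also have "(\<integral>x. indicator B x \<partial>cube_measure 1) = measure (cube_measure 1) (B \<inter> space (cube_measure 1))"
    by simp
  also have "\<dots> = measure lborel B"
    using B(2) space_cube_measure[of 1, where 'a = "real ^ 'n"]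
    by (simp add: cube_measure_def measure_restrict_space Int_absorb2)
  finally show ?thesis .
qed

text \<open>
  An upper bound for closed sets is enough for Weyl's criterion: for a box it is applied to the
  closed box and to the complement of the open box.
\<close>

lemma weyl_closed_upper:
  fixes u :: "nat \<Rightarrow> real ^ 'n"
  assumes weyl_sums: "\<And>h. integer_vec h \<Longrightarrow> h \<noteq> 0 \<Longrightarrow> (\<lambda>N. (\<Sum>n=1..N. character h (u n)) / of_nat N) \<longlonglongrightarrow> 0"
    and B: "compact B" "B \<subseteq> cbox 0 One" "B \<noteq> {}" and "c > measure lborel B"
  shows "\<forall>\<^sub>F N in sequentially. real (card {n \<in> {1..N}. frac_vec (u n) \<in> B}) / real N < c"
proof -
  \<comment> \<open>The integrals tend to the volume of \<open>B\<close>, so some single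
    \<open>k\<close> is good enough. The frequency of visits to \<open>B\<close> is at most the
    average of this bump, and that average converges to its integral.\<close>
  obtain k where k: "(\<integral>x. bump (torus_map ` B) k (torus_map x) \<partial>cube_measure 1) < c"
    using order_tendstoD(2)[OF integral_bump_tendsto[OF B] \<open>c > measure lborel B\<close>]
    by (auto simp: eventually_sequentially)
  have "\<forall>\<^sub>F N in sequentially. (\<Sum>n=1..N. bump (torus_map ` B) k (torus_map (u n))) / real N < c"
    using continuous_average_tendsto[OF weyl_sums continuous_on_bump] k by (rule order_tendstoD(2))
  then show ?thesis
  proof eventually_elim
    case (elim N)
    have "real (card {n \<in> {1..N}. frac_vec (u n) \<in> B}) = (\<Sum>n\<in>{n \<in> {1..N}. frac_vec (u n) \<in> B}. 1)"
      by simp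
    also have "\<dots> \<le> (\<Sum>n\<in>{n \<in> {1..N}. frac_vec (u n) \<in> B}. bump (torus_map ` B) k (torus_map (u n)))"
    proof (rule sum_mono)
      fix n assume "n \<in> {n \<in> {1..N}. frac_vec (u n) \<in> B}"
      then have "torus_map (u n) \<in> torus_map ` B" by (metis (mono_tags) imageI mem_Collect_eq torus_map_frac_vec)
      then show "1 \<le> bump (torus_map ` B) k (torus_map (u n))" by (simp add: bump_def)
    qed
    also have "\<dots> \<le> (\<Sum>n=1..N. bump (torus_map ` B) k (torus_map (u n)))"
      by (rule sum_mono2) (auto simp: bump_def)
    finally have "real (card {n \<in> {1..N}. frac_vec (u n) \<in> B}) / real N
        \<le> (\<Sum>n=1..N. bump (torus_map ` B) k (torus_map (u n))) / real N"
      by (intro divide_right_mono) auto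
    with elim show ?case by simp
  qed
qed

theorem weyl_criterion:
  fixes u :: "nat \<Rightarrow> real ^ 'n"
  assumes weyl_sums: "\<And>h. integer_vec h \<Longrightarrow> h \<noteq> 0 \<Longrightarrow> (\<lambda>N. (\<Sum>n=1..N. character h (u n)) / of_nat N) \<longlonglongrightarrow> 0"
  shows "uniformly_distributed_mod1 u"
  unfolding uniformly_distributed_mod1_def
proof (intro allI impI)
  fix a b :: "real ^ 'n"
  assume ab: "\<forall>i. 0 \<le> a $ i \<and> a $ i < b $ i \<and> b $ i \<le> 1"
  define V where "V = (\<Prod>i\<in>UNIV. b $ i - a $ i)"
  define c where "c N = real (card {n \<in> {1..N}. \<forall>i. frac (u n $ i) \<in> {a $ i..<b $ i}}) / real N" for N
  have ne: "cbox a b \<noteq> {}" using ab by (auto simp: interval_ne_empty_cart less_imp_le)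
  have le: "\<And>i. i \<in> Basis \<Longrightarrow> a \<bullet> i \<le> b \<bullet> i" using ne by (simp add: box_ne_empty)
  have mc: "measure lborel (cbox a b) = V" unfolding V_def by (rule content_cbox_cart[OF ne])
  then have mb: "measure lborel (box a b) = V" using le by simp
  \<comment> \<open>Points missing the half-open box have fractional parts in the compact set
    \<open>C\<close>, of volume \<open>1 - V\<close>. An upper bound for the frequency of
    \<open>C\<close> is therefore a lower bound for that of the box.\<close>
  define C where "C = cbox 0 One - box a b"
  have sub: "cbox a b \<subseteq> cbox 0 One"
  proof
    fix x assume "x \<in> cbox a b"
    then have "\<forall>i. a $ i \<le> x $ i \<and> x $ i \<le> b $ i" by (simp add: mem_box_cart)
    with ab show "x \<in> cbox 0 One" unfolding mem_cbox_One_iff by (meson order_trans)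
  qed
  then have sub': "box a b \<subseteq> cbox 0 One" using box_subset_cbox by blast
  have mC: "measure lborel C = 1 - V"
    unfolding C_def mb[symmetric]
    by (subst measure_Diff) (use sub' in \<open>auto simp: emeasure_lborel_cbox_eq emeasure_lborel_box_eq\<close>)
  \<comment> \<open>The corner \<open>a\<close> witnesses that \<open>C\<close> is nonempty, as
    \<open>weyl_closed_upper\<close> requires, even when the box is the whole cube.\<close>
  have "a \<in> cbox a b" "a \<notin> box a b" using ab by (auto simp: mem_box_cart less_imp_le)
  with sub have "a \<in> C" by (auto simp: C_def)
  then have C: "compact C" "C \<subseteq> cbox 0 One" "C \<noteq> {}"
    unfolding C_def by (auto intro: compact_diff)
  show "c \<longlonglongrightarrow> V"
  proof (rule order_tendstoI)
    fix y assume "V < y"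
    then have "\<forall>\<^sub>F N in sequentially. real (card {n \<in> {1..N}. frac_vec (u n) \<in> cbox a b}) / real N < y"
      using mc by (intro weyl_closed_upper weyl_sums sub ne) auto
    then show "\<forall>\<^sub>F N in sequentially. c N < y"
    proof eventually_elim
      case (elim N)
      have "c N \<le> real (card {n \<in> {1..N}. frac_vec (u n) \<in> cbox a b}) / real N"
        unfolding c_def by (intro divide_right_mono of_nat_mono card_mono)
          (auto simp: mem_box_cart frac_vec_def less_imp_le)
      with elim show ?case by simp
    qed
  next
    fix y assume "y < V"
    then have "\<forall>\<^sub>F N in sequentially. real (card {n \<in> {1..N}. frac_vec (u n) \<in> C}) / real N < 1 - y"
      using mC by (intro weyl_closed_upper weyl_sums C) auto
    then show "\<forall>\<^sub>F N in sequentially. y < c N"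
      using eventually_gt_at_top[of 0]
    proof eventually_elim
      case (elim N)
      let ?P = "{n \<in> {1..N}. \<forall>i. frac (u n $ i) \<in> {a $ i..<b $ i}}"
      let ?Q = "{n \<in> {1..N}. frac_vec (u n) \<in> C}"
      have "frac_vec (u n) \<in> C" if out: "\<not> (\<forall>i. frac (u n $ i) \<in> {a $ i..<b $ i})" for n
      proof -
        obtain i where "frac (u n $ i) \<notin> {a $ i..<b $ i}" using out by blast
        then have "\<not> (a $ i < frac_vec (u n) $ i \<and> frac_vec (u n) $ i < b $ i)"
          by (auto simp: frac_vec_def)
        then have "frac_vec (u n) \<notin> box a b" unfolding mem_box_cart by blast
        moreover have "frac_vec (u n) \<in> cbox 0 One"
          by (auto simp: mem_cbox_One_iff frac_vec_def less_imp_le frac_lt_1 simp del: mem_box_cart)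
        ultimately show ?thesis by (simp add: C_def)
      qed
      then have "{1..N} \<subseteq> ?P \<union> ?Q" by blast
      then have "card {1..N} \<le> card (?P \<union> ?Q)" by (intro card_mono) auto
      also have "\<dots> \<le> card ?P + card ?Q" by (rule card_Un_le)
      finally have "real N \<le> real (card ?P) + real (card ?Q)" by simp
      with elim(2) have "1 \<le> c N + real (card ?Q) / real N" by (simp add: c_def field_simps)
      with elim(1) show ?case by simp
    qed
  qed
qed

subsection \<open>Hausdorff null sets\<close>

lemma hausdorff_premeasure_le_cover:
  assumes "E \<subseteq> (\<Union>i. U i)" "\<And>i. bounded (U i)" "\<And>i. diameter (U i) \<le> \<delta>"
  shows "hausdorff_premeasure s \<delta> E \<le> (\<Sum>i. diam_power s (U i))"
  unfolding hausdorff_premeasure_def using assms by (intro INF_lower) auto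

lemma hausdorff_premeasure_mono:
  assumes "E \<subseteq> F"
  shows "hausdorff_premeasure s \<delta> E \<le> hausdorff_premeasure s \<delta> F"
  unfolding hausdorff_premeasure_def using assms by (intro INF_superset_mono) auto

text \<open>Choose for each \<open>E i\<close> a cover that is optimal up to
  \<open>e / 2 ^ Suc i\<close>, and enumerate all the covers as one sequence with
  \<open>prod_decode\<close>. The errors add up to \<open>e\<close>.\<close>

lemma hausdorff_premeasure_countable_subadditive:
  "hausdorff_premeasure s \<delta> (\<Union>i::nat. E i) \<le> (\<Sum>i. hausdorff_premeasure s \<delta> (E i))"
proof (rule ennreal_le_epsilon)
  fix e :: real assume fin: "(\<Sum>i. hausdorff_premeasure s \<delta> (E i)) < top" and "0 < e"
  have "\<exists>U. E i \<subseteq> (\<Union>j. U j) \<and> (\<forall>j. bounded (U j) \<and> diameter (U j) \<le> \<delta>) \<and>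
      (\<Sum>j. diam_power s (U j)) \<le> hausdorff_premeasure s \<delta> (E i) + ennreal (e * (1/2) ^ Suc i)"
    (is "\<exists>U. ?P U") for i
  proof (rule ccontr)
    assume c: "\<not> (\<exists>U. ?P U)"
    \<comment> \<open>If no near-optimal cover existed, the infimum would exceed itself by a
      positive amount. This is absurd because it is finite, being a term of a finite sum.\<close>
    have "hausdorff_premeasure s \<delta> (E i) + ennreal (e * (1/2) ^ Suc i) \<le> hausdorff_premeasure s \<delta> (E i)"
      unfolding hausdorff_premeasure_def[of s \<delta> "E i"]
      by (rule INF_greatest) (use c in \<open>force simp: hausdorff_premeasure_def\<close>)
    moreover have "hausdorff_premeasure s \<delta> (E i) < top"
      using fin by (meson ennreal_suminf_lessD)
    ultimately show False
      using mult_pos_pos[OF \<open>0 < e\<close> zero_less_power[of "1/2 :: real" i]]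
      by (cases "hausdorff_premeasure s \<delta> (E i)")
        (auto simp: ennreal_plus[symmetric] simp del: ennreal_plus)
  qed
  then obtain U where U: "\<And>i. E i \<subseteq> (\<Union>j. U i j)" "\<And>i j. bounded (U i j)"
      "\<And>i j. diameter (U i j) \<le> \<delta>"
      "\<And>i. (\<Sum>j. diam_power s (U i j)) \<le> hausdorff_premeasure s \<delta> (E i) + ennreal (e * (1/2) ^ Suc i)"
    by metis
  have "(\<Union>i. E i) \<subseteq> (\<Union>k. case_prod U (prod_decode k))"
  proof clarify
    fix x i assume "x \<in> E i"
    with U(1) obtain j where "x \<in> U i j" by blast
    then show "x \<in> (\<Union>k. case_prod U (prod_decode k))"
      by (intro UN_I[of "prod_encode (i, j)"]) auto
  qed
  then have "hausdorff_premeasure s \<delta> (\<Union>i. E i) \<le> (\<Sum>k. diam_power s (case_prod U (prod_decode k)))"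
    using U(2,3) by (intro hausdorff_premeasure_le_cover) (auto split: prod.split)
  also have "\<dots> = (\<Sum>i. \<Sum>j. diam_power s (U i j))"
    using suminf_ennreal_2dimen[of "\<lambda>i. \<Sum>j. diam_power s (U i j)" "\<lambda>p. diam_power s (case_prod U p)"]
    by (simp add: o_def)
  also have "\<dots> \<le> (\<Sum>i. hausdorff_premeasure s \<delta> (E i) + ennreal (e * (1/2) ^ Suc i))"
    by (intro suminf_le U(4)) auto
  also have "\<dots> = (\<Sum>i. hausdorff_premeasure s \<delta> (E i)) + (\<Sum>i. ennreal (e * (1/2) ^ Suc i))"
    by (intro suminf_add[symmetric]) auto
  also have "(\<Sum>i. ennreal (e * (1/2) ^ Suc i)) = ennreal e"
    using \<open>0 < e\<close> sums_mult[OF power_half_series, of e] by (intro suminf_ennreal_eq) auto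
  finally show "hausdorff_premeasure s \<delta> (\<Union>i. E i) \<le> (\<Sum>i. hausdorff_premeasure s \<delta> (E i)) + ennreal e" .
qed

lemma hausdorff_premeasure_finite_cover:
  assumes "finite \<Q>" "E \<subseteq> \<Union>\<Q>" "s > 0" "r \<ge> 0" "r \<le> \<delta>"
    and "\<And>Q. Q \<in> \<Q> \<Longrightarrow> bounded Q" "\<And>Q. Q \<in> \<Q> \<Longrightarrow> diameter Q \<le> r"
  shows "hausdorff_premeasure s \<delta> E \<le> ennreal (real (card \<Q>) * r powr s)"
proof -
  obtain f where f: "bij_betw f {..<card \<Q>} \<Q>"
    using assms(1) by (metis ex_bij_betw_nat_finite lessThan_atLeast0)
  \<comment> \<open>Covers are infinite sequences, so the finite one is padded with empty sets, to
    which \<open>diam_power\<close> assigns 0.\<close>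
  define U where "U = (\<lambda>i. if i < card \<Q> then f i else {})"
  have fQ: "f i \<in> \<Q>" if "i < card \<Q>" for i
    using f that by (auto simp: bij_betw_def)
  have "\<Union>\<Q> \<subseteq> (\<Union>i. U i)"
  proof (rule Union_least)
    fix Q assume "Q \<in> \<Q>"
    then obtain i where "i < card \<Q>" "Q = f i" using f by (auto simp: bij_betw_def)
    then show "Q \<subseteq> (\<Union>i. U i)" by (force simp: U_def)
  qed
  then have "hausdorff_premeasure s \<delta> E \<le> (\<Sum>i. diam_power s (U i))"
  proof (intro hausdorff_premeasure_le_cover)
    show "bounded (U i)" for i using assms(6) fQ by (simp add: U_def)
    show "diameter (U i) \<le> \<delta>" for i
      using assms(4,5) assms(7)[OF fQ, of i] by (auto simp: U_def)
  qed (use assms(2) in auto)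
  also have "\<dots> = (\<Sum>i<card \<Q>. diam_power s (U i))"
    by (rule suminf_finite) (auto simp: U_def diam_power_def)
  also have "\<dots> \<le> (\<Sum>i<card \<Q>. ennreal (r powr s))"
    using assms fQ by (intro sum_mono)
      (auto simp: diam_power_def U_def intro!: ennreal_leI powr_mono2 diameter_ge_0)
  also have "\<dots> = ennreal (real (card \<Q>) * r powr s)"
    by (simp add: ennreal_mult ennreal_of_nat_eq_real_of_nat)
  finally show ?thesis .
qed

lemma hausdorff_measure_eq_0_iff:
  "hausdorff_measure s E = 0 \<longleftrightarrow> (\<forall>\<delta>>0. hausdorff_premeasure s \<delta> E = 0)"
  unfolding hausdorff_measure_def bot_ennreal[symmetric]
  by (subst SUP_eq_iff) auto

text \<open>Measure zero means that every premeasure vanishes, and at each fixed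
  \<open>\<delta>\<close> countable subadditivity applies. The empty index set is separate because
  \<open>from_nat_into\<close> enumerates only nonempty sets.\<close>

lemma hausdorff_measure_countable_Union_eq_0:
  assumes "countable I" "\<And>i. i \<in> I \<Longrightarrow> hausdorff_measure s (E i) = 0" "F \<subseteq> (\<Union>i\<in>I. E i)"
  shows "hausdorff_measure s F = 0"
proof (cases "I = {}")
  case True
  have "hausdorff_premeasure s \<delta> F = 0" if "\<delta> > 0" for \<delta>
    using hausdorff_premeasure_le_cover[of F "\<lambda>_. {}" \<delta> s] True assms(3) that
    by (simp add: diam_power_def)
  then show ?thesis by (simp add: hausdorff_measure_eq_0_iff)
next
  case False
  have "hausdorff_premeasure s \<delta> F = 0" if "\<delta> > 0" for \<delta>
  proof -
    have "hausdorff_premeasure s \<delta> F \<le> hausdorff_premeasure s \<delta> (\<Union>n. E (from_nat_into I n))"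
      using assms(1,3) False by (intro hausdorff_premeasure_mono) (simp flip: UN_from_nat_into add: image_image[symmetric])
    also have "\<dots> \<le> (\<Sum>n. hausdorff_premeasure s \<delta> (E (from_nat_into I n)))"
      by (rule hausdorff_premeasure_countable_subadditive)
    also have "\<dots> = 0"
      using assms(2) False that by (simp add: hausdorff_measure_eq_0_iff from_nat_into)
    finally show ?thesis by simp
  qed
  then show ?thesis by (simp add: hausdorff_measure_eq_0_iff)
qed

text \<open>The convergence half of Borel-Cantelli: the limsup set is covered by every tail of the
  \<open>B k\<close>, and the tails of a convergent series are small. For each
  \<open>\<delta>\<close> the bound is asked only eventually, since covers of \<open>B k\<close> may
  become finer than \<open>\<delta>\<close> only for large \<open>k\<close>.\<close>

lemma hausdorff_measure_limsup_eq_0: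
  assumes "summable w" "\<And>k. w k \<ge> 0"
    and cov: "\<And>\<delta>. \<delta> > 0 \<Longrightarrow> \<forall>\<^sub>F k in sequentially. hausdorff_premeasure s \<delta> (B k) \<le> ennreal (w k)"
  shows "hausdorff_measure s {x. \<exists>\<^sub>F k in sequentially. x \<in> B k} = 0"
proof -
  have "hausdorff_premeasure s \<delta> {x. \<exists>\<^sub>F k in sequentially. x \<in> B k} \<le> 0" (is "?H \<le> 0") if \<delta>: "\<delta> > 0" for \<delta>
  proof (rule ennreal_le_epsilon)
    fix e :: real assume "0 < e"
    obtain k0 where k0: "\<And>k. k \<ge> k0 \<Longrightarrow> hausdorff_premeasure s \<delta> (B k) \<le> ennreal (w k)"
      using cov[OF \<delta>] by (auto simp: eventually_sequentially)
    obtain k1 where k1: "\<And>n. n \<ge> k1 \<Longrightarrow> norm (\<Sum>i. w (i + n)) < e"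
      using suminf_exist_split[OF \<open>0 < e\<close> assms(1)] by blast
    define K where "K = max k0 k1"
    have "{x. \<exists>\<^sub>F k in sequentially. x \<in> B k} \<subseteq> (\<Union>i. B (i + K))"
    proof clarify
      fix x assume "\<exists>\<^sub>F k in sequentially. x \<in> B k"
      then obtain k where "k \<ge> K" "x \<in> B k" by (auto simp: frequently_sequentially)
      then show "x \<in> (\<Union>i. B (i + K))" by (intro UN_I[of "k - K"]) auto
    qed
    then have "?H \<le> (\<Sum>i. hausdorff_premeasure s \<delta> (B (i + K)))"
      by (rule order_trans[OF hausdorff_premeasure_mono hausdorff_premeasure_countable_subadditive])
    also have "\<dots> \<le> (\<Sum>i. ennreal (w (i + K)))"
      by (intro suminf_le k0) (auto simp: K_def)
    also have "\<dots> = ennreal (\<Sum>i. w (i + K))"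
      using assms(1,2) by (intro suminf_ennreal2) (auto simp: summable_iff_shift)
    also have "\<dots> \<le> ennreal e"
      using k1[of K] by (intro ennreal_leI) (auto simp: K_def)
    finally show "?H \<le> 0 + ennreal e" by simp
  qed
  then show ?thesis by (auto simp: hausdorff_measure_eq_0_iff)
qed

subsection \<open>Large Weyl sums\<close>

text \<open>Chebyshev's inequality on a grid of mesh \<open>1 / q\<close>. If the norm of
  \<open>S\<close> reaches \<open>\<alpha>\<close> at one point of a cell, the Lipschitz bound keeps
  it above \<open>\<alpha> / 2\<close> on the whole cell. The cells found this way have total volume
  at most \<open>W / (\<alpha> / 2)\<^sup>2\<close>, and each has volume
  \<open>1 / q ^ DIM('a)\<close>.\<close>

lemma superlevel_cover:
  fixes S :: "'a::euclidean_space \<Rightarrow> complex"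
  assumes cont: "continuous_on UNIV S"
    and lip: "\<And>x y. norm (S x - S y) \<le> \<Lambda> * dist x y" and "\<Lambda> \<ge> 0"
    and q: "q \<ge> 1" "\<Lambda> * (DIM('a) / real q) \<le> \<alpha> / 2" and "\<alpha> > 0"
    and W: "(\<integral>x. (norm (S x))\<^sup>2 \<partial>cube_measure 2) \<le> W"
  obtains \<Q> where "finite \<Q>" "{x \<in> cbox 0 One. \<alpha> \<le> norm (S x)} \<subseteq> \<Union>\<Q>"
    "\<And>Q. Q \<in> \<Q> \<Longrightarrow> bounded Q" "\<And>Q. Q \<in> \<Q> \<Longrightarrow> diameter Q \<le> DIM('a) / real q"
    "real (card \<Q>) * \<alpha>\<^sup>2 \<le> 4 * real q ^ DIM('a) * W"
proof -
  define lo hi :: "('a \<Rightarrow> nat) \<Rightarrow> 'a"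
    where "lo k = (\<Sum>b\<in>Basis. (real (k b) / q) *\<^sub>R b)"
      and "hi k = (\<Sum>b\<in>Basis. ((real (k b) + 1) / q) *\<^sub>R b)" for k
  \<comment> \<open>Cells with an index equal to \<open>q\<close> stick out of the unit cube: they catch the points with a
    coordinate 1, and they are why the mean square is taken over the cube of side 2.\<close>
  define J where "J = {k \<in> Basis \<rightarrow>\<^sub>E {..q}. \<exists>x\<in>cbox (lo k) (hi k). \<alpha> \<le> norm (S x)}"
  have lo: "lo k \<bullet> b = real (k b) / q" and hi: "hi k \<bullet> b = (real (k b) + 1) / q" if "b \<in> Basis" for k b
    using that by (simp_all add: lo_def hi_def)
  have finJ: "finite J" unfolding J_def by (simp add: finite_PiE)
  have dist: "dist x y \<le> DIM('a) / real q" if "x \<in> cbox (lo k) (hi k)" "y \<in> cbox (lo k) (hi k)" for x y k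
  proof -
    \<comment> \<open>The l1 bound costs a factor \<open>DIM('a)\<close> instead of its square root,
      which is harmless.\<close>
    have "dist x y \<le> (\<Sum>b\<in>Basis. \<bar>(x - y) \<bullet> b\<bar>)" unfolding dist_norm by (rule norm_le_l1)
    also have "\<dots> \<le> (\<Sum>b\<in>(Basis :: 'a set). 1 / real q)"
    proof (rule sum_mono)
      fix b :: 'a assume b: "b \<in> Basis"
      have "real (k b) / q \<le> x \<bullet> b" "x \<bullet> b \<le> real (k b) / q + 1 / q"
           "real (k b) / q \<le> y \<bullet> b" "y \<bullet> b \<le> real (k b) / q + 1 / q"
        using that b lo[OF b, of k] hi[OF b, of k] by (auto simp: mem_box add_divide_distrib)
      then show "\<bar>(x - y) \<bullet> b\<bar> \<le> 1 / real q" by (simp add: inner_diff_left)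
    qed
    finally show ?thesis by simp
  qed
  have half: "\<alpha> / 2 \<le> norm (S x)" if "k \<in> J" "x \<in> cbox (lo k) (hi k)" for k x
  proof -
    obtain y where y: "y \<in> cbox (lo k) (hi k)" "\<alpha> \<le> norm (S y)" using \<open>k \<in> J\<close> by (auto simp: J_def)
    have "norm (S y - S x) \<le> \<Lambda> * dist y x" by (rule lip)
    also have "\<dots> \<le> \<Lambda> * (DIM('a) / real q)"
      using dist[OF y(1) that(2)] \<open>\<Lambda> \<ge> 0\<close> by (rule mult_left_mono)
    also have "\<dots> \<le> \<alpha> / 2" by (rule q)
    finally show ?thesis using y(2) norm_triangle_ineq2[of "S y" "S x"] by linarith
  qed
  \<comment> \<open>Open cells are disjoint and have the same volume as the closed cells used for
    covering.\<close>
  define U where "U = (\<Union>k\<in>J. box (lo k) (hi k))"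
  have Uc: "U \<subseteq> cbox 0 (2 *\<^sub>R One)"
  proof
    fix x assume "x \<in> U"
    then obtain k where k: "k \<in> J" "x \<in> box (lo k) (hi k)" by (auto simp: U_def)
    have "0 \<le> x \<bullet> b \<and> x \<bullet> b \<le> 2" if b: "b \<in> Basis" for b
    proof -
      have "k b \<le> q" using k(1) b by (auto simp: J_def PiE_iff)
      then have "(real (k b) + 1) / q \<le> 2" using q(1) by (simp add: field_simps)
      moreover have "real (k b) / q < x \<bullet> b" "x \<bullet> b < (real (k b) + 1) / q"
        using k(2) b lo[OF b, of k] hi[OF b, of k] by (auto simp: mem_box)
      moreover have "0 \<le> real (k b) / q" by simp
      ultimately show ?thesis by linarith
    qed
    then show "x \<in> cbox 0 (2 *\<^sub>R One)" by (auto simp: mem_box)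
  qed
  have disj: "disjoint_family_on (\<lambda>k. box (lo k) (hi k)) J"
    unfolding disjoint_family_on_def
  proof (intro ballI impI equals0I)
    fix k l x assume kl: "k \<in> J" "l \<in> J" "k \<noteq> l" and x: "x \<in> box (lo k) (hi k) \<inter> box (lo l) (hi l)"
    \<comment> \<open>An interior point determines its cell: the index is the integer part of
      \<open>q * (x \<bullet> b)\<close>.\<close>
    have val: "int (m b) = \<lfloor>q * (x \<bullet> b)\<rfloor>" if "x \<in> box (lo m) (hi m)" "b \<in> Basis" for m b
    proof -
      have "real (m b) / q < x \<bullet> b" "x \<bullet> b < (real (m b) + 1) / q"
        using that lo[of b m] hi[of b m] by (auto simp: mem_box)
      then have "real (m b) < q * (x \<bullet> b)" "q * (x \<bullet> b) < real (m b) + 1"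
        using q(1) by (simp_all add: field_simps)
      then show ?thesis by linarith
    qed
    have "k b = l b" if "b \<in> Basis" for b
      using val[of k b] val[of l b] x that by simp
    with kl show False unfolding J_def by (auto intro: PiE_ext)
  qed
  have "measure lborel U = (\<Sum>k\<in>J. measure lborel (box (lo k) (hi k)))"
    unfolding U_def using finJ disj by (intro measure_finite_Union) (auto simp: emeasure_lborel_box_eq)
  also have "\<dots> = (\<Sum>k\<in>J. (1 / real q) ^ DIM('a))"
  proof (intro sum.cong refl)
    fix k
    have "measure lborel (box (lo k) (hi k)) = (\<Prod>b\<in>Basis. (hi k - lo k) \<bullet> b)"
      by (rule measure_lborel_box) (simp add: lo hi divide_right_mono)
    also have "\<dots> = (\<Prod>b\<in>(Basis :: 'a set). 1 / real q)"
      by (intro prod.cong refl) (simp add: inner_diff_left lo hi flip: diff_divide_distrib)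
    finally show "measure lborel (box (lo k) (hi k)) = (1 / real q) ^ DIM('a)" by simp
  qed
  finally have mU: "measure lborel U = real (card J) * (1 / real q) ^ DIM('a)" by simp
  have Ub: "U \<in> sets borel" unfolding U_def by (intro borel_open open_UN) (auto simp: open_box)
  have "(\<alpha> / 2)\<^sup>2 * measure lborel U = (\<alpha> / 2)\<^sup>2 * measure (cube_measure 2) (U \<inter> space (cube_measure 2))"
    using Uc Ub space_cube_measure[of 2, where 'a = 'a]
    by (simp add: cube_measure_def measure_restrict_space Int_absorb2)
  also have "\<dots> = (\<integral>x. (\<alpha> / 2)\<^sup>2 * indicator U x \<partial>cube_measure 2)" by simp
  also have "\<dots> \<le> (\<integral>x. (norm (S x))\<^sup>2 \<partial>cube_measure 2)"
  proof (rule integral_mono)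
    have "indicator U \<in> borel_measurable (cube_measure 2)"
      unfolding cube_measure_def using Ub by (intro measurable_restrict_space1) simp
    then have "integrable (cube_measure 2) (indicator U :: 'a \<Rightarrow> real)"
      by (intro finite_measure.integrable_const_bound[OF finite_measure_cube, where B = 1])
        (auto simp: indicator_def)
    then show "integrable (cube_measure 2) (\<lambda>x. (\<alpha> / 2)\<^sup>2 * indicator U x)" by simp
    show "integrable (cube_measure 2) (\<lambda>x. (norm (S x))\<^sup>2)"
      by (intro integrable_cube_continuous continuous_intros cont)
    fix x
    show "(\<alpha> / 2)\<^sup>2 * indicator U x \<le> (norm (S x))\<^sup>2"
    proof (cases "x \<in> U")
      case True
      then obtain k where "k \<in> J" "x \<in> cbox (lo k) (hi k)" using box_subset_cbox by (auto simp: U_def)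
      then have "\<alpha> / 2 \<le> norm (S x)" by (rule half)
      then have "(\<alpha> / 2)\<^sup>2 \<le> (norm (S x))\<^sup>2" using \<open>\<alpha> > 0\<close> by (intro power_mono) auto
      with True show ?thesis by simp
    qed simp
  qed
  also have "\<dots> \<le> W" by (rule W)
  finally have count: "real (card J) * \<alpha>\<^sup>2 \<le> 4 * real q ^ DIM('a) * W"
    using q(1) by (simp add: mU field_simps)
  show ?thesis
  proof
    let ?Q = "(\<lambda>k. cbox (lo k) (hi k)) ` J"
    show "finite ?Q" using finJ by simp
    show "{x \<in> cbox 0 One. \<alpha> \<le> norm (S x)} \<subseteq> \<Union>?Q"
    proof clarify
      fix x :: 'a assume x: "x \<in> cbox 0 One" "\<alpha> \<le> norm (S x)"
      define k where "k = (\<lambda>b\<in>Basis. nat \<lfloor>q * (x \<bullet> b)\<rfloor>)"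
      have kb: "real (k b) \<le> q * (x \<bullet> b) \<and> q * (x \<bullet> b) \<le> real (k b) + 1 \<and> k b \<le> q" if b: "b \<in> Basis" for b
      proof -
        have "0 \<le> x \<bullet> b" "x \<bullet> b \<le> 1" using x(1) b by (auto simp: mem_box)
        then have r: "0 \<le> q * (x \<bullet> b)" "q * (x \<bullet> b) \<le> q" by (auto simp: mult_left_le)
        have "k b = nat \<lfloor>q * (x \<bullet> b)\<rfloor>" using b by (simp add: k_def)
        with r show ?thesis by linarith
      qed
      have "x \<in> cbox (lo k) (hi k)"
        using kb q(1) by (auto simp: mem_box lo hi field_simps)
      moreover have "k \<in> Basis \<rightarrow>\<^sub>E {..q}" using kb by (auto simp: k_def)
      ultimately have "k \<in> J" using x(2) by (auto simp: J_def)
      with \<open>x \<in> cbox (lo k) (hi k)\<close> show "x \<in> \<Union>?Q" by auto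
    qed
    show "bounded Q" if "Q \<in> ?Q" for Q using that by auto
    show "diameter Q \<le> DIM('a) / real q" if "Q \<in> ?Q" for Q
      using that dist by (intro diameter_le) (auto simp: dist_norm)
    have "real (card ?Q) * \<alpha>\<^sup>2 \<le> real (card J) * \<alpha>\<^sup>2"
      by (intro mult_right_mono of_nat_mono card_image_le finJ) auto
    with count show "real (card ?Q) * \<alpha>\<^sup>2 \<le> 4 * real q ^ DIM('a) * W" by linarith
  qed
qed

text \<open>Apply \<open>superlevel_cover\<close> with \<open>q\<close> of order
  \<open>N powr \<tau>\<close>, which balances the Lipschitz constant
  \<open>O(N * N powr \<tau>)\<close> against the level \<open>\<epsilon> * N\<close>. It yields
  \<open>O(q powr d / N)\<close> cells of diameter \<open>d / q\<close>; the condition on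
  \<open>\<delta>\<close> makes them admissible.\<close>

lemma superlevel_premeasure_bound:
  fixes v :: "nat \<Rightarrow> 'a::euclidean_space" and s \<tau> :: real
  assumes int: "\<And>n. n \<ge> 1 \<Longrightarrow> integer_vec (v n)" and inj: "inj_on v {1..}"
    and "C > 0" and growth: "\<And>N. N \<ge> 1 \<Longrightarrow> (\<Sum>n=1..N. norm (v n)) \<le> C * real N * real N powr \<tau>"
    and "\<tau> > 0" "\<epsilon> > 0" and s: "0 < s" "s < DIM('a)"
  obtains c D where "c \<ge> 0" "D > 0"
    "\<forall>N\<ge>1. \<forall>\<delta>\<ge>D * real N powr (- \<tau>).
      hausdorff_premeasure s \<delta> {x \<in> cbox 0 One. \<epsilon> * real N \<le> norm (\<Sum>n=1..N. character (v n) x)}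
        \<le> ennreal (c * real N powr (\<tau> * (DIM('a) - s) - 1))"
proof -
  define d where "d = real DIM('a)"
  \<comment> \<open>The first summand makes the oscillation on a cell at most
    \<open>\<epsilon> * N / 2\<close>. The added 1 gives \<open>D * N powr \<tau> \<ge> 1\<close>,
    so that rounding up to \<open>q\<close> at most doubles it.\<close>
  define D where "D = 4 * pi * C * d / \<epsilon> + 1"
  \<comment> \<open>Here \<open>4 * 2 ^ DIM('a) / \<epsilon>\<^sup>2\<close> comes from the number
    of cells and the mean square over the cube of side 2, \<open>d powr s\<close> from their
    diameters, and the last factor from \<open>q \<le> 2 * D * N powr \<tau>\<close>.\<close>
  define c where "c = 4 * 2 ^ DIM('a) * d powr s / \<epsilon>\<^sup>2 * (2 * D) powr (d - s)"
  have d: "d \<ge> 1" unfolding d_def by (simp add: DIM_positive Suc_leI)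
  have D: "D \<ge> 1" unfolding D_def using \<open>C > 0\<close> \<open>\<epsilon> > 0\<close> d by simp
  show ?thesis
  proof
    show "c \<ge> 0" unfolding c_def by simp
    \<comment> \<open>The witness for the \<open>D\<close> of the conclusion is
      \<open>d / D\<close>, because the cells have diameter
      \<open>d / q \<le> d / (D * N powr \<tau>)\<close>.\<close>
    show "d / D > 0" using d D by simp
  next
    show "\<forall>N\<ge>1. \<forall>\<delta>\<ge>d / D * real N powr (- \<tau>).
      hausdorff_premeasure s \<delta> {x \<in> cbox 0 One. \<epsilon> * real N \<le> norm (\<Sum>n=1..N. character (v n) x)}
        \<le> ennreal (c * real N powr (\<tau> * (DIM('a) - s) - 1))"
    proof (intro allI impI)
      fix N :: nat and \<delta> :: real
      assume N: "N \<ge> 1" and \<delta>: "d / D * real N powr (- \<tau>) \<le> \<delta>"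
      let ?S = "\<lambda>x. \<Sum>n=1..N. character (v n) x"
      define q where "q = nat \<lceil>D * real N powr \<tau>\<rceil>"
      have N1: "real N powr \<tau> \<ge> 1" using N \<open>\<tau> > 0\<close> by (simp add: ge_one_powr_ge_zero)
      have DN: "D * real N powr \<tau> \<ge> 1" using mult_mono[OF D N1] D by simp
      have q: "D * real N powr \<tau> \<le> real q" "real q \<le> 2 * D * real N powr \<tau>"
        using DN unfolding q_def by linarith+
      have q1: "q \<ge> 1" using DN q(1) by linarith
      define \<Lambda> where "\<Lambda> = 2 * pi * (\<Sum>n=1..N. norm (v n))"
      have \<Lambda>: "\<Lambda> \<ge> 0" unfolding \<Lambda>_def by (simp add: sum_nonneg)
      have lip: "norm (?S x - ?S y) \<le> \<Lambda> * dist x y" for x y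
      proof -
        have "norm (?S x - ?S y) \<le> (\<Sum>n=1..N. norm (character (v n) x - character (v n) y))"
          unfolding sum_subtractf[symmetric] by (rule norm_sum)
        also have "\<dots> \<le> (\<Sum>n=1..N. 2 * pi * norm (v n) * dist x y)"
          by (intro sum_mono norm_character_diff_le)
        finally show ?thesis by (simp add: \<Lambda>_def sum_distrib_left sum_distrib_right mult_ac)
      qed
      have osc: "\<Lambda> * (DIM('a) / real q) \<le> \<epsilon> * real N / 2"
      proof -
        have "\<Lambda> \<le> 2 * pi * (C * real N * real N powr \<tau>)"
          unfolding \<Lambda>_def using growth[OF N] by (intro mult_left_mono) auto
        then have "\<Lambda> * d \<le> 2 * pi * (C * real N * real N powr \<tau>) * d" using d by (intro mult_right_mono) auto
        also have "\<dots> = \<epsilon> * real N / 2 * ((4 * pi * C * d / \<epsilon>) * real N powr \<tau>)"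
          using \<open>\<epsilon> > 0\<close> by (simp add: field_simps)
        also have "\<dots> \<le> \<epsilon> * real N / 2 * real q"
        proof (rule mult_left_mono)
          have "(4 * pi * C * d / \<epsilon>) * real N powr \<tau> \<le> D * real N powr \<tau>"
            by (intro mult_right_mono) (auto simp: D_def)
          with q(1) show "(4 * pi * C * d / \<epsilon>) * real N powr \<tau> \<le> real q" by linarith
        qed (use \<open>\<epsilon> > 0\<close> in auto)
        finally show ?thesis using q1 by (simp add: field_simps d_def)
      qed
      have \<alpha>: "\<epsilon> * real N > 0" using \<open>\<epsilon> > 0\<close> N by simp
      have "(\<integral>x. (norm (?S x))\<^sup>2 \<partial>cube_measure 2) = real 2 ^ DIM('a) * real (card {1..N})"
        using inj by (intro integral_cube_norm_character_sum_sq) (auto intro: int inj_on_subset)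
      then have W: "(\<integral>x. (norm (?S x))\<^sup>2 \<partial>cube_measure 2) \<le> 2 ^ DIM('a) * real N" by simp
      obtain \<Q> where Q: "finite \<Q>" "{x \<in> cbox 0 One. \<epsilon> * real N \<le> norm (?S x)} \<subseteq> \<Union>\<Q>"
        "\<And>Q. Q \<in> \<Q> \<Longrightarrow> bounded Q" "\<And>Q. Q \<in> \<Q> \<Longrightarrow> diameter Q \<le> DIM('a) / real q"
        "real (card \<Q>) * (\<epsilon> * real N)\<^sup>2 \<le> 4 * real q ^ DIM('a) * (2 ^ DIM('a) * real N)"
        by (rule superlevel_cover[OF _ lip \<Lambda> q1 osc \<alpha> W]) (intro continuous_intros, blast)
      have "d / real q \<le> d / (D * real N powr \<tau>)"
        using q(1) DN d by (intro divide_left_mono) auto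
      also have "\<dots> \<le> \<delta>" using \<delta> by (simp add: powr_minus field_simps)
      finally have "hausdorff_premeasure s \<delta> {x \<in> cbox 0 One. \<epsilon> * real N \<le> norm (?S x)}
          \<le> ennreal (real (card \<Q>) * (d / real q) powr s)"
        using Q d s(1) by (intro hausdorff_premeasure_finite_cover) (auto simp: d_def)
      also have "real (card \<Q>) * (d / real q) powr s \<le> c * real N powr (\<tau> * (d - s) - 1)"
      proof -
        have "real (card \<Q>) \<le> 4 * real q ^ DIM('a) * (2 ^ DIM('a) * real N) / (\<epsilon> * real N)\<^sup>2"
          using Q(5) zero_less_power[OF \<alpha>, of 2] by (simp only: pos_le_divide_eq)
        also have "\<dots> = 4 * 2 ^ DIM('a) / \<epsilon>\<^sup>2 * real q powr d * real N powr (- 1)"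
          using q1 N by (simp add: d_def powr_realpow powr_minus power2_eq_square field_simps)
        finally have "real (card \<Q>) * (d / real q) powr s
            \<le> (4 * 2 ^ DIM('a) / \<epsilon>\<^sup>2 * real q powr d * real N powr (- 1)) * (d / real q) powr s"
          by (intro mult_right_mono) auto
        also have "\<dots> = 4 * 2 ^ DIM('a) * d powr s / \<epsilon>\<^sup>2 * real q powr (d - s) * real N powr (- 1)"
          using q1 d by (simp add: powr_divide powr_diff mult_ac)
        \<comment> \<open>Since \<open>s < DIM('a)\<close>, the exponent of \<open>q\<close> is
          positive and the upper bound on \<open>q\<close> is the relevant one.\<close>
        also have "\<dots> \<le> 4 * 2 ^ DIM('a) * d powr s / \<epsilon>\<^sup>2 * (2 * D * real N powr \<tau>) powr (d - s) * real N powr (- 1)"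
          using q(2) s(2) by (intro mult_right_mono mult_left_mono powr_mono2) (auto simp: d_def)
        also have "\<dots> = c * real N powr (\<tau> * (d - s) - 1)"
        proof -
          have "real N powr (\<tau> * (d - s)) * real N powr (- 1) = real N powr (\<tau> * (d - s) - 1)"
            by (subst powr_add[symmetric]) simp
          moreover have "(2 * D * real N powr \<tau>) powr (d - s) = (2 * D) powr (d - s) * real N powr (\<tau> * (d - s))"
            using D by (simp add: powr_mult powr_powr)
          ultimately show ?thesis by (simp only: c_def mult.assoc)
        qed
        finally show ?thesis .
      qed
      finally show "hausdorff_premeasure s \<delta> {x \<in> cbox 0 One. \<epsilon> * real N \<le> norm (?S x)}
          \<le> ennreal (c * real N powr (\<tau> * (DIM('a) - s) - 1))"
        by (simp add: d_def ennreal_leI)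
    qed
  qed
qed

text \<open>For \<open>k ^ M \<le> N < Suc k ^ M\<close> the sums up to \<open>N\<close> and up to
  \<open>k ^ M\<close> differ by at most \<open>Suc k ^ M - k ^ M\<close> terms of norm at most 1.
  This is \<open>o(k ^ M)\<close> because \<open>Suc k / k\<close> tends to 1.\<close>

lemma average_tendsto_0_along_powers:
  fixes a :: "nat \<Rightarrow> 'b::real_normed_vector"
  assumes bd: "\<And>n. norm (a n) \<le> 1" and "M \<ge> 1"
    and small: "\<And>j. \<forall>\<^sub>F k in sequentially. norm (\<Sum>n=1..k ^ M. a n) < 1 / real (Suc j) * real (k ^ M)"
  shows "(\<lambda>N. (\<Sum>n=1..N. a n) /\<^sub>R real N) \<longlonglongrightarrow> 0"
proof (rule LIMSEQ_I)
  fix e :: real assume "0 < e"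
  \<comment> \<open>One half of \<open>e\<close> pays for the sum up to \<open>k ^ M\<close>, the
    other for the remaining terms.\<close>
  then obtain j where j: "1 / real (Suc j) < e / 2"
    using reals_Archimedean[of "e / 2"] by (auto simp: inverse_eq_divide)
  have "(\<lambda>k. (real (Suc k) / real k) ^ M) \<longlonglongrightarrow> 1 ^ M"
    by (intro tendsto_power LIMSEQ_Suc_n_over_n)
  then have "\<forall>\<^sub>F k in sequentially. (real (Suc k) / real k) ^ M < 1 + e / 2"
    using \<open>0 < e\<close> by (intro order_tendstoD) auto
  with small[of j] have "\<forall>\<^sub>F k in sequentially. k \<ge> 1 \<and> (real (Suc k) / real k) ^ M < 1 + e / 2 \<and>
      norm (\<Sum>n=1..k ^ M. a n) < 1 / real (Suc j) * real (k ^ M)"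
    using eventually_ge_at_top[of 1] by eventually_elim auto
  then obtain K where K: "\<And>k. k \<ge> K \<Longrightarrow> k \<ge> 1 \<and> (real (Suc k) / real k) ^ M < 1 + e / 2 \<and>
      norm (\<Sum>n=1..k ^ M. a n) < 1 / real (Suc j) * real (k ^ M)"
    by (auto simp: eventually_sequentially)
  show "\<exists>N0. \<forall>N\<ge>N0. norm ((\<Sum>n=1..N. a n) /\<^sub>R real N - 0) < e"
  proof (intro exI allI impI)
    fix N assume N: "N \<ge> K ^ M"
    \<comment> \<open>Minimality gives \<open>k ^ M \<le> N\<close> for the predecessor
      \<open>k\<close> of \<open>m\<close>, which exists because \<open>0 ^ M = 0\<close> when
      \<open>M \<ge> 1\<close>.\<close>
    define m where "m = (LEAST m. N < m ^ M)"
    have "N < Suc N ^ M" using \<open>M \<ge> 1\<close> self_le_power[of "Suc N" M] by simp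
    then have m: "N < m ^ M" unfolding m_def by (rule LeastI)
    with \<open>M \<ge> 1\<close> have "m \<noteq> 0" by (cases "m = 0") (simp_all add: power_0_left)
    then obtain k where mk: "m = Suc k" by (cases m) auto
    have kN: "k ^ M \<le> N" using not_less_Least[of k "\<lambda>m. N < m ^ M"] mk by (simp add: m_def not_less)
    have "K \<le> k"
    proof (rule ccontr)
      assume "\<not> K \<le> k"
      then have "m ^ M \<le> K ^ M" using mk by (intro power_mono) auto
      with m N show False by simp
    qed
    note K = K[OF this]
    have kM: "real (k ^ M) > 0" using K by simp
    have "(\<Sum>n=1..N. a n) = (\<Sum>n=1..k ^ M. a n) + (\<Sum>n=Suc (k ^ M)..N. a n)"
      using sum.ub_add_nat[of 1 "k ^ M" a "N - k ^ M"] kN by simp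
    then have "norm (\<Sum>n=1..N. a n) \<le> norm (\<Sum>n=1..k ^ M. a n) + norm (\<Sum>n=Suc (k ^ M)..N. a n)"
      by (simp add: norm_triangle_ineq)
    also have "norm (\<Sum>n=Suc (k ^ M)..N. a n) \<le> (\<Sum>n=Suc (k ^ M)..N. 1)"
      by (intro sum_norm_le bd)
    also have "(\<Sum>n=Suc (k ^ M)..N. 1) \<le> real (Suc k ^ M) - real (k ^ M)"
      using m mk kN by (simp add: of_nat_diff flip: of_nat_power)
    also have "real (Suc k ^ M) - real (k ^ M) < e / 2 * real (k ^ M)"
    proof -
      have "real (Suc k ^ M) = (real (Suc k) / real k) ^ M * real (k ^ M)"
        using K by (simp add: power_divide)
      also have "\<dots> < (1 + e / 2) * real (k ^ M)"
        using K kM by (intro mult_strict_right_mono) auto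
      finally show ?thesis by (simp add: algebra_simps)
    qed
    also have "norm (\<Sum>n=1..k ^ M. a n) < e / 2 * real (k ^ M)"
      using K mult_strict_right_mono[OF j kM] by linarith
    finally have "norm (\<Sum>n=1..N. a n) < e * real (k ^ M)" by (simp add: field_simps)
    also have "\<dots> \<le> e * real N" using kN \<open>0 < e\<close> by (intro mult_left_mono of_nat_mono) auto
    finally have "norm (\<Sum>n=1..N. a n) < e * real N" .
    moreover have "real N > 0" using kM of_nat_mono[OF kN, where 'a = real] by linarith
    ultimately show "norm ((\<Sum>n=1..N. a n) /\<^sub>R real N - 0) < e"
      by (simp add: pos_divide_less_eq flip: divide_inverse_commute)
  qed
qed

lemma hausdorff_measure_weyl_sum_exceptions:
  fixes v :: "nat \<Rightarrow> 'a::euclidean_space" and s \<tau> :: real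
  assumes int: "\<And>n. n \<ge> 1 \<Longrightarrow> integer_vec (v n)" and inj: "inj_on v {1..}"
    and "C > 0" and growth: "\<And>N. N \<ge> 1 \<Longrightarrow> (\<Sum>n=1..N. norm (v n)) \<le> C * real N * real N powr \<tau>"
    and "\<tau> > 0" and s: "0 < s" "s < DIM('a)" "DIM('a) - 1 / \<tau> < s"
  shows "hausdorff_measure s {x \<in> cbox 0 One. \<not> (\<lambda>N. (\<Sum>n=1..N. character (v n) x) / of_nat N) \<longlonglongrightarrow> 0} = 0"
proof -
  \<comment> \<open>The premeasure bound at \<open>N\<close> is
    \<open>O(N powr (- \<gamma>))\<close>, and \<open>\<gamma> > 0\<close> restates
    \<open>DIM('a) - 1 / \<tau> < s\<close>. Taking \<open>M * \<gamma> \<ge> 2\<close> makes the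
    bounds along \<open>N = k ^ M\<close> at most a constant times \<open>1 / k\<^sup>2\<close>,
    hence summable.\<close>
  define \<gamma> where "\<gamma> = 1 - \<tau> * (DIM('a) - s)"
  have "\<gamma> > 0" using s(3) \<open>\<tau> > 0\<close> by (simp add: \<gamma>_def field_simps)
  obtain M :: nat where M: "2 / \<gamma> < real M" using reals_Archimedean2 by blast
  moreover have "2 / \<gamma> > 0" using \<open>\<gamma> > 0\<close> by simp
  ultimately have "real M > 0" by linarith
  then have M1: "M \<ge> 1" by simp
  have M2: "real M * \<gamma> \<ge> 2" using M \<open>\<gamma> > 0\<close> by (simp add: field_simps)
  \<comment> \<open>The levels \<open>1 / Suc j\<close> replace all positive
    \<open>\<epsilon>\<close> by countably many. A point in none of the limsup sets satisfies the
    hypothesis of \<open>average_tendsto_0_along_powers\<close>.\<close>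
  define B where "B j k = {x \<in> cbox 0 (One :: 'a).
      1 / real (Suc j) * real (k ^ M) \<le> norm (\<Sum>n=1..k ^ M. character (v n) x)}" for j k
  have null: "hausdorff_measure s {x. \<exists>\<^sub>F k in sequentially. x \<in> B j k} = 0" for j
  proof -
    have j: "1 / real (Suc j) > 0" by simp
    obtain c D where cD: "c \<ge> 0" "D > 0"
      "\<forall>N\<ge>1. \<forall>\<delta>\<ge>D * real N powr (- \<tau>).
        hausdorff_premeasure s \<delta> {x \<in> cbox 0 One. 1 / real (Suc j) * real N \<le> norm (\<Sum>n=1..N. character (v n) x)}
          \<le> ennreal (c * real N powr (\<tau> * (DIM('a) - s) - 1))"
      by (rule superlevel_premeasure_bound[OF int inj \<open>C > 0\<close> growth \<open>\<tau> > 0\<close> j s(1,2)])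
    show ?thesis
    proof (rule hausdorff_measure_limsup_eq_0[where w = "\<lambda>k. c * inverse (real k ^ 2)"])
      show "summable (\<lambda>k. c * inverse (real k ^ 2))"
        by (intro summable_mult inverse_power_summable) auto
      show "c * inverse (real k ^ 2) \<ge> 0" for k using cD(1) by simp
      fix \<delta> :: real assume "\<delta> > 0"
      have "filterlim (\<lambda>k. real (k ^ M)) at_top sequentially"
      proof (rule filterlim_at_top_mono[OF filterlim_real_sequentially])
        show "\<forall>\<^sub>F k in sequentially. real k \<le> real (k ^ M)"
          using eventually_ge_at_top[of 1]
        proof eventually_elim
          case (elim k)
          then have "k \<le> k ^ M" using M1 by (intro self_le_power) auto
          then show ?case by (rule of_nat_mono)
        qed
      qed
      then have "(\<lambda>k. D * real (k ^ M) powr (- \<tau>)) \<longlonglongrightarrow> D * 0"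
        using \<open>\<tau> > 0\<close> by (intro tendsto_mult tendsto_const tendsto_neg_powr) auto
      then have "\<forall>\<^sub>F k in sequentially. D * real (k ^ M) powr (- \<tau>) < \<delta>"
        using \<open>\<delta> > 0\<close> by (intro order_tendstoD) auto
      then show "\<forall>\<^sub>F k in sequentially. hausdorff_premeasure s \<delta> (B j k) \<le> ennreal (c * inverse (real k ^ 2))"
        using eventually_ge_at_top[of 1]
      proof eventually_elim
        case (elim k)
        have "hausdorff_premeasure s \<delta> (B j k) \<le> ennreal (c * real (k ^ M) powr (\<tau> * (DIM('a) - s) - 1))"
          unfolding B_def using elim by (intro cD(3)[rule_format]) auto
        also have "\<dots> \<le> ennreal (c * inverse (real k ^ 2))"
        proof (intro ennreal_leI mult_left_mono cD(1))
          have "real (k ^ M) = real k powr real M" using elim(2) by (simp add: powr_realpow)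
          moreover have "real M * (\<tau> * (DIM('a) - s) - 1) = - (real M * \<gamma>)"
            by (simp add: \<gamma>_def algebra_simps)
          ultimately have "real (k ^ M) powr (\<tau> * (DIM('a) - s) - 1) = real k powr (- (real M * \<gamma>))"
            by (simp only: powr_powr)
          also have "\<dots> \<le> real k powr (- 2)"
            using elim(2) M2 by (intro powr_mono) auto
          also have "\<dots> = inverse (real k ^ 2)"
            using elim(2) by (simp add: powr_minus)
          finally show "real (k ^ M) powr (\<tau> * (DIM('a) - s) - 1) \<le> inverse (real k ^ 2)" .
        qed
        finally show ?case .
      qed
    qed
  qed
  show ?thesis
  proof (rule hausdorff_measure_countable_Union_eq_0[OF _ null])
    show "{x \<in> cbox 0 One. \<not> (\<lambda>N. (\<Sum>n=1..N. character (v n) x) / of_nat N) \<longlonglongrightarrow> 0}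
        \<subseteq> (\<Union>j\<in>UNIV. {x. \<exists>\<^sub>F k in sequentially. x \<in> B j k})"
    proof (rule subsetI, rule ccontr)
      fix x assume x: "x \<in> {x \<in> cbox 0 One. \<not> (\<lambda>N. (\<Sum>n=1..N. character (v n) x) / of_nat N) \<longlonglongrightarrow> 0}"
        and "x \<notin> (\<Union>j\<in>UNIV. {x. \<exists>\<^sub>F k in sequentially. x \<in> B j k})"
      then have "\<forall>\<^sub>F k in sequentially. x \<notin> B j k" for j by (auto simp: not_frequently)
      then have "\<forall>\<^sub>F k in sequentially. norm (\<Sum>n=1..k ^ M. character (v n) x) < 1 / real (Suc j) * real (k ^ M)" for j
        by (rule eventually_mono) (use x in \<open>auto simp: B_def not_le\<close>)
      then have "(\<lambda>N. (\<Sum>n=1..N. character (v n) x) /\<^sub>R real N) \<longlonglongrightarrow> 0"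
        by (intro average_tendsto_0_along_powers[OF _ M1]) auto
      with x show False by (simp add: scaleR_conv_of_real field_simps)
    qed
  qed simp
qed

subsection \<open>Matrix sequences\<close>

lemma norm_vector_matrix_mult_le_row_opnorm:
  fixes A :: "real ^ 'n ^ 'm"
  shows "norm (x v* A) \<le> row_opnorm A * norm x"
proof (cases "x = 0")
  case False
  have bl: "bounded_linear (\<lambda>x. x v* A)"
    using matrix_vector_mul_bounded_linear[of "transpose A"]
    by (rule back_subst[of bounded_linear]) (simp add: fun_eq_iff)
  obtain K where K: "\<And>x. norm (x v* A) \<le> norm x * K"
    using bounded_linear.bounded[OF bl] by blast
  \<comment> \<open>The supremum in \<open>row_opnorm\<close> bounds its members only once the set
    is known to be bounded above.\<close>
  have "bdd_above ((\<lambda>x. norm (x v* A)) ` {x. norm x = 1})"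
    by (rule bdd_aboveI2[of _ _ K]) (metis K mem_Collect_eq mult_1)
  then have "norm ((x /\<^sub>R norm x) v* A) \<le> row_opnorm A"
    unfolding row_opnorm_def using False by (intro cSUP_upper) auto
  moreover have "(x /\<^sub>R norm x) v* A = (x v* A) /\<^sub>R norm x"
    by (rule linear_scale[OF bounded_linear.linear[OF bl]])
  ultimately show ?thesis using False by (simp add: field_simps)
qed simp

text \<open>A matrix and its transpose have the same operator norm, and one inequality suffices: the
  square of the norm of \<open>A *v h\<close> equals \<open>((A *v h) v* A) \<bullet> h\<close>, to
  which Cauchy-Schwarz and the row bound apply. It is needed because the growth hypothesis concerns
  row vectors while the frequencies are \<open>A n *v h\<close>.\<close>

lemma norm_matrix_vector_mult_le_row_opnorm:
  fixes A :: "real ^ 'n ^ 'm"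
  shows "norm (A *v h) \<le> row_opnorm A * norm h"
proof (cases "A *v h = 0")
  case True
  have "0 \<le> row_opnorm A"
    using order_trans[OF norm_ge_zero norm_vector_matrix_mult_le_row_opnorm[of "axis undefined 1" A]]
    by simp
  with True show ?thesis by simp
next
  case False
  have "norm (A *v h) * norm (A *v h) = ((A *v h) v* A) \<bullet> h"
    by (simp add: dot_lmul_matrix flip: power2_norm_eq_inner power2_eq_square)
  also have "\<dots> \<le> norm ((A *v h) v* A) * norm h" by (rule norm_cauchy_schwarz)
  also have "\<dots> \<le> row_opnorm A * norm (A *v h) * norm h"
    by (intro mult_right_mono norm_vector_matrix_mult_le_row_opnorm) auto
  finally show ?thesis using False by (simp add: mult_ac)
qed

lemma integer_vec_cart_iff: "integer_vec h \<longleftrightarrow> (\<forall>i. h $ i \<in> \<int>)" for h :: "real ^ 'n"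
  unfolding integer_vec_def by (rule Ball_Basis_vec_iff)

lemma countable_integer_vec: "countable {h :: real ^ 'n. integer_vec h}"
proof (rule countable_subset)
  show "{h :: real ^ 'n. integer_vec h} \<subseteq> range (\<lambda>f :: 'n \<Rightarrow> int. \<chi> i. of_int (f i))"
  proof clarify
    fix h :: "real ^ 'n" assume "integer_vec h"
    then have "h = (\<chi> i. of_int \<lfloor>h $ i\<rfloor>)"
      by (simp add: integer_vec_cart_iff vec_eq_iff)
    then show "h \<in> range (\<lambda>f :: 'n \<Rightarrow> int. \<chi> i. of_int (f i))" by (intro image_eqI[of _ _ "\<lambda>i. \<lfloor>h $ i\<rfloor>"]) auto
  qed
qed simp

theorem theorem3p9:
  fixes A :: "nat \<Rightarrow> real ^ 'n ^ 'n" and \<tau> :: real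
  assumes integer_entries: "\<And>n i j. n \<ge> 1 \<Longrightarrow> A n $ i $ j \<in> \<int>"
    and tau: "\<tau> \<ge> 1 / real CARD('n)"
    and growth: "\<exists>c>0. \<forall>N\<ge>1. (1 / real N) * (\<Sum>n=1..N. row_opnorm (A n)) \<le> c * real N powr \<tau>"
    and differences_invertible:
      "\<And>m n. m \<ge> 1 \<Longrightarrow> n \<ge> 1 \<Longrightarrow> n \<noteq> m \<Longrightarrow> invertible (A n - A m)"
  shows "hausdorff_dim (exceptional_set A) \<le> ereal (real CARD('n) - 1 / \<tau>)"
proof -
  let ?d = "real CARD('n)"
  have "1 / ?d > 0" by simp
  with tau have "\<tau> > 0" by linarith
  \<comment> \<open>This makes every \<open>s\<close> above the bound positive, as the null set
    lemma and the infimum in \<open>hausdorff_dim\<close> require.\<close>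
  have d\<tau>: "?d - 1 / \<tau> \<ge> 0" using tau \<open>\<tau> > 0\<close> by (simp add: field_simps)
  obtain c where c: "c > 0" "\<And>N. N \<ge> 1 \<Longrightarrow> (1 / real N) * (\<Sum>n=1..N. row_opnorm (A n)) \<le> c * real N powr \<tau>"
    using growth by blast
  have null: "hausdorff_measure s (exceptional_set A) = 0" if s: "?d - 1 / \<tau> < s" "s < ?d" for s
  proof (rule hausdorff_measure_countable_Union_eq_0)
    let ?H = "{h :: real ^ 'n. integer_vec h \<and> h \<noteq> 0}"
    let ?E = "\<lambda>h. {x \<in> cbox 0 One. \<not> (\<lambda>N. (\<Sum>n=1..N. character (A n *v h) x) / of_nat N) \<longlonglongrightarrow> 0}"
    show "countable ?H" using countable_subset[OF _ countable_integer_vec, of ?H] by blast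
    show "exceptional_set A \<subseteq> (\<Union>h\<in>?H. ?E h)"
    proof
      fix x assume "x \<in> exceptional_set A"
      then have x: "x \<in> cbox 0 One" and nu: "\<not> uniformly_distributed_mod1 (\<lambda>n. x v* A n)"
        unfolding exceptional_set_def mem_Collect_eq mem_cbox_One_iff by blast+
      from nu obtain h where "h \<in> ?H" "\<not> (\<lambda>N. (\<Sum>n=1..N. character h (x v* A n)) / of_nat N) \<longlonglongrightarrow> 0"
        using weyl_criterion[of "\<lambda>n. x v* A n"] by auto
      \<comment> \<open>Duality turns Weyl sums of the orbit of \<open>x\<close> into sums of
        characters in the variable \<open>x\<close>.\<close>
      moreover have "character h (x v* A n) = character (A n *v h) x" for n
        by (simp add: character_def dot_lmul_matrix inner_commute[of h] inner_commute[of "A n *v h"])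
      ultimately show "x \<in> (\<Union>h\<in>?H. ?E h)" using x by auto
    qed
    fix h assume h: "h \<in> ?H"
    show "hausdorff_measure s (?E h) = 0"
    proof (rule hausdorff_measure_weyl_sum_exceptions)
      show "integer_vec (A n *v h)" if "n \<ge> 1" for n
        using h integer_entries[OF that]
        by (auto simp: integer_vec_cart_iff matrix_vector_mult_def intro!: Ints_sum Ints_mult)
      show "inj_on (\<lambda>n. A n *v h) {1..}"
      proof (rule inj_onI, rule ccontr)
        fix m n assume mn: "m \<in> {1..}" "n \<in> {1..}" "A m *v h = A n *v h" "m \<noteq> n"
        then have "invertible (A m - A n)" by (intro differences_invertible) auto
        \<comment> \<open>Invertibility of the difference makes the frequencies distinct: equal
          images of \<open>h\<close> would put \<open>h \<noteq> 0\<close> in its kernel.\<close>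
        then obtain A' where "A' ** (A m - A n) = mat 1" by (auto simp: invertible_def)
        moreover have "(A m - A n) *v h = 0" using mn(3) by (simp add: matrix_vector_mult_diff_rdistrib)
        ultimately have "h = 0" by (metis matrix_vector_mul_assoc matrix_vector_mul_lid matrix_vector_mult_0_right)
        with h show False by simp
      qed
      show "c * norm h > 0" using c(1) h by simp
      show "(\<Sum>n=1..N. norm (A n *v h)) \<le> c * norm h * real N * real N powr \<tau>" if N: "N \<ge> 1" for N
      proof -
        have "(\<Sum>n=1..N. norm (A n *v h)) \<le> (\<Sum>n=1..N. row_opnorm (A n) * norm h)"
          by (intro sum_mono norm_matrix_vector_mult_le_row_opnorm)
        also have "\<dots> = (\<Sum>n=1..N. row_opnorm (A n)) * norm h" by (simp add: sum_distrib_right)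
        also have "\<dots> \<le> (c * real N powr \<tau> * real N) * norm h"
          using c(2)[OF N] N by (intro mult_right_mono) (auto simp: field_simps)
        finally show ?thesis by (simp add: mult_ac)
      qed
    qed (use s d\<tau> \<open>\<tau> > 0\<close> in auto)
  qed
  show ?thesis
  \<comment> \<open>It suffices to bound the dimension by each \<open>y\<close> above
    \<open>?d - 1 / \<tau>\<close>. Nullity was shown only for \<open>s < ?d\<close>, so
    \<open>s\<close> is chosen below \<open>min y ?d\<close>; there is room because
    \<open>1 / \<tau> > 0\<close>.\<close>
  proof (rule dense_ge)
    fix y assume y: "ereal (?d - 1 / \<tau>) < y"
    have "?d - 1 / \<tau> < ?d" using \<open>\<tau> > 0\<close> by simp
    then have "ereal (?d - 1 / \<tau>) < min y (ereal ?d)" using y by simp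
    then obtain s where s: "ereal (?d - 1 / \<tau>) < ereal s" "ereal s < min y (ereal ?d)"
      using ereal_dense2 by blast
    then have "hausdorff_measure s (exceptional_set A) = 0" "0 \<le> s"
      using d\<tau> by (auto intro!: null)
    then have "hausdorff_dim (exceptional_set A) \<le> ereal s"
      unfolding hausdorff_dim_def by (intro INF_lower) auto
    also have "\<dots> \<le> y" using s(2) by (simp add: less_imp_le)
    finally show "hausdorff_dim (exceptional_set A) \<le> y" .
  qed
qed

end
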